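(* Assume the potentials are harmonic, i.e. $U(x)=V(x)=x^2/2$, and that the heat conduction network diffusion has a unique invariant probability measure. Then this invariant measure has full support (its support is $\mathbb{R}^n$) if and only if $\dim\mathcal{E}_{M,\partial\mathcal{V}}=n$.
   Context: Let $G=(\mathcal{V},\sim)$ be a finite connected graph with $N=|\mathcal{V}|$ vertices, identified with $\{1,\dots,N\}$, and let $n=2N$. Let $\mathcal{D}\subset\mathcal{V}$ be a non-empty subset (damped set) and $\partial\mathcal{V}\subset\mathcal{D}$ a non-empty subset (boundary set), with temperatures $T_i>0$ for $i\in\partial\mathcal{V}$. Each vertex $i$ has position $q_i\in\mathbb{R}$ and momentum $p_i\in\mathbb{R}$. The Hamiltonian is $$H(q,p)=\sum_{i\in\mathcal{V}}\Big(\tfrac12p_i^2+V(q_i)+\tfrac12\sum_{j\sim i}U(q_i-q_j)\Big).$$ The heat conduction network is the diffusion $Z=(q,p)\in\mathbb{R}^n$ solving, for $i\in\mathcal{V}$, $$dq_i=p_i\,dt,\qquad dp_i=-\partial_{q_i}H\,dt-p_i\mathbf{1}_{i\in\mathcal{D}}\,dt+\sqrt{2T_i}\,\mathbf{1}_{i\in\partial\mathcal{V}}\,dB_i,$$ with $(B_i)_{i\in\partial\mathcal{V}}$ independent Brownian motions. Let $(P_t)$ be its semigroup; a probability measure $\mu$ on $\mathbb{R}^n$ is invariant if $P_t^\star\mu=\mu$ for all $t\ge0$, where $P_t^\star\mu(A)=\int P_t(z,A)\,\mu(dz)$. In the harmonic case the equation reads $dZ_t=MZ_t\,dt+\sigma\,dB_t$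 with $$M=\begin{pmatrix}0&I\\-\Gamma&-I_{\mathcal{D}}\end{pmatrix},\quad \sigma=\begin{pmatrix}0&0\\0&T_{\partial\mathcal{V}}\end{pmatrix},$$ where $\Gamma=I+\Delta$, $\Delta=D-\Lambda$ is the graph Laplacian ($\Lambda$ the adjacency matrix, $D$ the diagonal degree matrix), $I_{\mathcal{D}}=\mathrm{diag}(\mathbf{1}_{i\in\mathcal{D}})$, $T_{\partial\mathcal{V}}=\mathrm{diag}(\sqrt{2T_i}\,\mathbf{1}_{i\in\partial\mathcal{V}})$. With $(e_1,\dots,e_n)$ the canonical basis of $\mathbb{R}^n$ and $\mathcal{I}\subset\mathcal{V}$, put $\mathcal{E}_{M,\mathcal{I}}=\mathrm{Span}\{M^ke_{i+N}:\ i\in\mathcal{I},\ k\in\mathbb{N}\}$. *)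

theory Defs
  imports "HOL-Probability.Probability"
begin

section \<open>Phase space\<close>

text \<open>
  The vertex set is a finite type \<open>'v\<close>, with \<open>N = CARD('v)\<close>. Phase space \<open>\<real>\<^sup>n\<close>, \<open>n = 2 N\<close>, is
  indexed by \<open>'v + 'v\<close>: coordinate \<open>Inl i\<close> is the position \<open>q\<^sub>i\<close> and coordinate \<open>Inr i\<close> is the
  momentum \<open>p\<^sub>i\<close> (index \<open>i + N\<close> in the usual enumeration).
\<close>

type_synonym 'v phase = "real ^ ('v + 'v)"

abbreviation position :: "'v::finite phase \<Rightarrow> 'v \<Rightarrow> real" where
  "position z i \<equiv> z $ Inl i"

abbreviation momentum :: "'v::finite phase \<Rightarrow> 'v \<Rightarrow> real" where
  "momentum z i \<equiv> z $ Inr i"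

section \<open>The heat conduction network\<close>

definition connected_graph :: "('v::finite \<Rightarrow> 'v \<Rightarrow> bool) \<Rightarrow> bool" where
  "connected_graph adj \<longleftrightarrow>
     (\<forall>i j. adj i j \<longrightarrow> adj j i) \<and> (\<forall>i. \<not> adj i i) \<and> (\<forall>i j. adj\<^sup>*\<^sup>* i j)"

definition hamiltonian ::
  "('v::finite \<Rightarrow> 'v \<Rightarrow> bool) \<Rightarrow> (real \<Rightarrow> real) \<Rightarrow> (real \<Rightarrow> real) \<Rightarrow> 'v phase \<Rightarrow> real" where
  "hamiltonian adj U V z =
     (\<Sum>i\<in>UNIV. (momentum z i)\<^sup>2 / 2 + V (position z i)
        + (\<Sum>j | adj j i. U (position z i - position z j)) / 2)"

definition partial_deriv :: "'n::finite \<Rightarrow> (real ^ 'n \<Rightarrow> real) \<Rightarrow> real ^ 'n \<Rightarrow> real" where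
  "partial_deriv k f z = deriv (\<lambda>h. f (z + h *\<^sub>R axis k 1)) 0"

definition brownian_motion :: "'w measure \<Rightarrow> (real \<Rightarrow> 'w \<Rightarrow> real) \<Rightarrow> bool" where
  "brownian_motion W b \<longleftrightarrow>
     prob_space W \<and>
     (\<forall>t\<ge>0. b t \<in> borel_measurable W) \<and>
     (AE \<omega> in W. b 0 \<omega> = 0) \<and>
     (AE \<omega> in W. continuous_on {0..} (\<lambda>t. b t \<omega>)) \<and>
     (\<forall>s t. 0 \<le> s \<and> s < t \<longrightarrow>
        distributed W lborel (\<lambda>\<omega>. b t \<omega> - b s \<omega>) (normal_density 0 (sqrt (t - s)))) \<and>
     (\<forall>(m::nat) \<tau>. 0 \<le> \<tau> 0 \<and> (\<forall>k<m. \<tau> k \<le> \<tau> (Suc k)) \<longrightarrow>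
        prob_space.indep_vars W (\<lambda>_. borel) (\<lambda>k \<omega>. b (\<tau> (Suc k)) \<omega> - b (\<tau> k) \<omega>) {..<m})"

text \<open>Independence of the Brownian motions is independence as processes, i.e. as random elements
  of the product space \<open>\<real>\<^bsup>[0,\<infinity>)\<^esup>\<close>.\<close>

definition indep_brownian_motions ::
  "'w measure \<Rightarrow> 'v set \<Rightarrow> ('v \<Rightarrow> real \<Rightarrow> 'w \<Rightarrow> real) \<Rightarrow> bool" where
  "indep_brownian_motions W I B \<longleftrightarrow>
     (\<forall>i\<in>I. brownian_motion W (B i)) \<and>
     prob_space.indep_vars W (\<lambda>_. PiM {0::real..} (\<lambda>_. borel))
       (\<lambda>i \<omega>. \<lambda>t\<in>{0..}. B i t \<omega>) I"

text \<open>
  The noise is additive, so the equation is meaningful path by path in integrated form: almost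
  surely the path is continuous, starts at \<open>z\<close>, and satisfies, for all \<open>t \<ge> 0\<close>,
  \<open>q\<^sub>i(t) - q\<^sub>i(0) = \<integral>\<^sub>0\<^sup>t p\<^sub>i ds\<close> and
  \<open>p\<^sub>i(t) - p\<^sub>i(0) - \<sqrt>(2 T\<^sub>i) 1\<^bsub>bdry\<^esub>(i) B\<^sub>i(t) = \<integral>\<^sub>0\<^sup>t (- \<partial>H/\<partial>q\<^sub>i - 1\<^bsub>damped\<^esub>(i) p\<^sub>i) ds\<close>.
\<close>

definition network_solution ::
  "('v::finite \<Rightarrow> 'v \<Rightarrow> bool) \<Rightarrow> (real \<Rightarrow> real) \<Rightarrow> (real \<Rightarrow> real) \<Rightarrow> 'v set \<Rightarrow> 'v set \<Rightarrow> ('v \<Rightarrow> real) \<Rightarrow>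
   'w measure \<Rightarrow> ('v \<Rightarrow> real \<Rightarrow> 'w \<Rightarrow> real) \<Rightarrow> 'v phase \<Rightarrow> (real \<Rightarrow> 'w \<Rightarrow> 'v phase) \<Rightarrow> bool" where
  "network_solution adj U V damped bdry T W B z Z \<longleftrightarrow>
     (\<forall>t\<ge>0. Z t \<in> borel_measurable W) \<and>
     (AE \<omega> in W.
        continuous_on {0..} (\<lambda>t. Z t \<omega>) \<and> Z 0 \<omega> = z \<and>
        (\<forall>t\<ge>0. \<forall>i.
           ((\<lambda>s. momentum (Z s \<omega>) i) has_integral
              (position (Z t \<omega>) i - position (Z 0 \<omega>) i)) {0..t} \<and>
           ((\<lambda>s. - partial_deriv (Inl i) (hamiltonian adj U V) (Z s \<omega>)
                 - momentum (Z s \<omega>) i * indicator damped i) has_integral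
              (momentum (Z t \<omega>) i - momentum (Z 0 \<omega>) i
                 - sqrt (2 * T i) * indicator bdry i * B i t \<omega>)) {0..t}))"

section \<open>Semigroup, invariant measures, support\<close>

text \<open>\<open>Z z\<close> is the solution started at \<open>z\<close>; \<open>transition W Z t z\<close> is \<open>P\<^sub>t(z, \<cdot>)\<close>.\<close>

definition transition ::
  "'w measure \<Rightarrow> ('s::topological_space \<Rightarrow> real \<Rightarrow> 'w \<Rightarrow> 's) \<Rightarrow> real \<Rightarrow> 's \<Rightarrow> 's measure" where
  "transition W Z t z = distr W borel (Z z t)"

definition invariant_prob ::
  "(real \<Rightarrow> 's::topological_space \<Rightarrow> 's measure) \<Rightarrow> 's measure \<Rightarrow> bool" where
  "invariant_prob P \<mu> \<longleftrightarrow>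
     prob_space \<mu> \<and> sets \<mu> = sets borel \<and>
     (\<forall>t\<ge>0. \<forall>A\<in>sets borel. (\<integral>\<^sup>+ z. emeasure (P t z) A \<partial>\<mu>) = emeasure \<mu> A)"

definition measure_support :: "'s::topological_space measure \<Rightarrow> 's set" where
  "measure_support \<mu> = {z. \<forall>G. open G \<and> z \<in> G \<longrightarrow> emeasure \<mu> G > 0}"

section \<open>The harmonic case\<close>

definition graph_laplacian :: "('v::finite \<Rightarrow> 'v \<Rightarrow> bool) \<Rightarrow> real ^ 'v ^ 'v" where
  "graph_laplacian adj =
     (\<chi> i j. if i = j then real (card {k. adj k i}) else 0) - (\<chi> i j. if adj i j then 1 else 0)"

definition block_matrix ::
  "real ^ 'a ^ 'c \<Rightarrow> real ^ 'b ^ 'c \<Rightarrow> real ^ 'a ^ 'd \<Rightarrow> real ^ 'b ^ 'd \<Rightarrow>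
   real ^ ('a::finite + 'b::finite) ^ ('c::finite + 'd::finite)" where
  "block_matrix A B C D =
     (\<chi> r c. case r of
        Inl i \<Rightarrow> (case c of Inl j \<Rightarrow> A $ i $ j | Inr j \<Rightarrow> B $ i $ j)
      | Inr i \<Rightarrow> (case c of Inl j \<Rightarrow> C $ i $ j | Inr j \<Rightarrow> D $ i $ j))"

definition drift_matrix ::
  "('v::finite \<Rightarrow> 'v \<Rightarrow> bool) \<Rightarrow> 'v set \<Rightarrow> real ^ ('v + 'v) ^ ('v + 'v)" where
  "drift_matrix adj damped =
     block_matrix 0 (mat 1)
       (- (mat 1 + graph_laplacian adj)) (- (\<chi> i j. if i = j then indicator damped i else 0))"

text \<open>Matrix powers are iterated application: \<open>^\<close> on \<open>real ^ 'n ^ 'n\<close> is not the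
  matrix power.\<close>

definition controllable_space ::
  "real ^ ('v + 'v) ^ ('v + 'v) \<Rightarrow> 'v::finite set \<Rightarrow> (real ^ ('v + 'v)) set" where
  "controllable_space M I = span {(((*v) M) ^^ k) (axis (Inr i) 1) | i k. i \<in> I}"

end

(*
  The solution from z is exp(tM) z + X_t, where X_t, the solution from 0, lies in the controllable
  space E.

  If E is the whole space, the law of X_1 charges every ball. For a vector v reached at time one by a
  Lipschitz control acting at a single boundary vertex, shifting the Gaussian increments of a time
  discretisation gives, uniformly in the mesh, E g(X_1) <= c/2 E g(X_1 + v) + C/c for 0 <= g <= 1
  and all c > 0, so the null balls of X_1 are stable under translation by the reachable vectors.
  These span the space, and a law without charged balls of radius r cannot exist.

  Conversely, assume full support. The vectors q all of whose images under powers of Gamma vanish on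
  the damped set form a subspace; projecting it out of both q and p commutes with M and does not see
  the noise, so it sends the invariant measure to an invariant measure. Uniqueness then forces the
  subspace to be 0, whence the energy strictly decreases along exp(tM) and exp(tM) tends to 0.
  A functional w orthogonal to E is not affected by the noise, so w . exp(tM) z has the same law under
  the invariant measure for all t, and w . z = 0 almost surely.
*)
theory Submission
  imports Defs
begin

section \<open>Linear flows\<close>

text \<open>The noise is additive, so no stochastic integral is needed: integrating by parts in the
  variation of constants formula gives x(t) = b(t) + exp(tM) z + \<integral> exp((t-s)M) M b(s) ds,
  where b is the noise path, and this makes sense for every continuous path. The formula is linear
  in b, and at time one it is a limit of sums that see b only at the points k/(n+1). Adding a
  control to the noise moves these sums by a deterministic vector, so shifting finitely many
  independent Gaussians replaces a change of measure on path space. The densities of these shifts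
  are not followed to the limit; only the inequality is. Its constant C depends on the control
  through its Lipschitz constant, not on n, so n can tend to infinity first and c afterwards. In the
  other direction the obstacle is that exp(tM) need not tend to 0: a mode that the damped vertices
  never see oscillates for ever. Such modes must be excluded before the flow can be used to move
  mass towards the origin.\<close>

definition flow :: "real ^ 'n ^ 'n \<Rightarrow> real \<Rightarrow> real ^ 'n::finite \<Rightarrow> real ^ 'n" where
  "flow M t z = (\<Sum>k. (t ^ k / fact k) *\<^sub>R (((*v) M) ^^ k) z)"

lemma norm_iterated_matrix_le:
  fixes M :: "real ^ 'n ^ 'n::finite"
  shows "norm ((((*v) M) ^^ k) z) \<le> onorm ((*v) M) ^ k * norm z"
proof (induction k)
  case (Suc k)
  have bl: "bounded_linear ((*v) M)" by simp
  have "norm ((((*v) M) ^^ Suc k) z) \<le> onorm ((*v) M) * norm ((((*v) M) ^^ k) z)"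
    by (simp add: onorm[OF bl])
  also have "\<dots> \<le> onorm ((*v) M) * (onorm ((*v) M) ^ k * norm z)"
    by (intro mult_left_mono Suc onorm_pos_le bl)
  finally show ?case by simp
qed simp

lemma summable_norm_flow:
  fixes M :: "real ^ 'n ^ 'n::finite"
  shows "summable (\<lambda>k. norm ((t ^ k / fact k) *\<^sub>R (((*v) M) ^^ k) z))"
proof (rule summable_comparison_test')
  show "summable (\<lambda>k. inverse (fact k) * (\<bar>t\<bar> * onorm ((*v) M)) ^ k * norm z)"
    by (intro summable_mult2 summable_exp)
next
  fix k
  have "\<bar>t\<bar> ^ k / fact k * norm ((((*v) M) ^^ k) z) \<le> \<bar>t\<bar> ^ k / fact k * (onorm ((*v) M) ^ k * norm z)"
    by (intro mult_left_mono norm_iterated_matrix_le) auto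
  then show "norm (norm ((t ^ k / fact k) *\<^sub>R (((*v) M) ^^ k) z))
      \<le> inverse (fact k) * (\<bar>t\<bar> * onorm ((*v) M)) ^ k * norm z"
    by (simp add: power_mult_distrib field_simps power_abs)
qed

lemma flow_sums:
  fixes M :: "real ^ 'n ^ 'n::finite"
  shows "(\<lambda>k. (t ^ k / fact k) *\<^sub>R (((*v) M) ^^ k) z) sums flow M t z"
  unfolding flow_def by (rule summable_sums[OF summable_norm_cancel[OF summable_norm_flow]])

lemma flow_bounded_linear_sums:
  fixes M :: "real ^ 'n ^ 'n::finite"
  assumes "bounded_linear f"
  shows "(\<lambda>k. (t ^ k / fact k) *\<^sub>R f ((((*v) M) ^^ k) z)) sums f (flow M t z)"
  using bounded_linear.sums[OF assms flow_sums[of t M z]]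
  by (simp add: linear_simps[OF assms])

lemma flow_0 [simp]: "flow M 0 z = z"
proof -
  have "(\<lambda>k. (0 ^ k / fact k) *\<^sub>R (((*v) M) ^^ k) z) = (\<lambda>k. if k = 0 then (((*v) M) ^^ k) z else 0)"
    by (auto simp: fun_eq_iff power_0_left)
  then have "(\<lambda>k. (0 ^ k / fact k) *\<^sub>R (((*v) M) ^^ k) z) sums z"
    using sums_single[of 0 "\<lambda>k. (((*v) M) ^^ k) z"] by simp
  then show ?thesis using sums_unique2[OF flow_sums] by blast
qed

lemma linear_iterated_matrix: "linear (((*v) (M :: real ^ 'n ^ 'n::finite)) ^^ k)"
proof (induction k)
  case (Suc k)
  then show ?case using linear_compose[OF Suc matrix_vector_mul_linear[of M]] by (simp only: funpow.simps)
qed (simp add: linear_iff)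

text \<open>Termwise, \<open>f\<close> turns iterates of \<open>M\<close> into iterates of
  \<open>M'\<close>. Used with \<open>f\<close> equal to \<open>M\<close> itself and with maps that
  commute with the drift.\<close>

lemma flow_intertwines:
  fixes M M' :: "real ^ 'n ^ 'n::finite"
  assumes f: "linear f" and comm: "\<And>z. f (M *v z) = M' *v f z"
  shows "f (flow M t z) = flow M' t (f z)"
proof -
  have k: "f ((((*v) M) ^^ k) z) = (((*v) M') ^^ k) (f z)" for k
    by (induction k) (auto simp: comm)
  then show ?thesis
    by (intro sums_unique2[OF _ flow_sums])
       (rule flow_bounded_linear_sums[OF linear_conv_bounded_linear[THEN iffD1, OF f], of t M z, unfolded k])
qed

lemma linear_flow: "linear (flow M t)"
proof (rule linearI)
  fix x y :: "real ^ 'a" and c :: real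
  have "(\<lambda>k. (t ^ k / fact k) *\<^sub>R (((*v) M) ^^ k) (x + y)) sums (flow M t x + flow M t y)"
    using sums_add[OF flow_sums[of t M x] flow_sums[of t M y]]
    by (simp add: linear_add[OF linear_iterated_matrix] scaleR_add_right)
  then show "flow M t (x + y) = flow M t x + flow M t y"
    using sums_unique2[OF flow_sums] by blast
  have "(\<lambda>k. (t ^ k / fact k) *\<^sub>R (((*v) M) ^^ k) (c *\<^sub>R x)) sums (c *\<^sub>R flow M t x)"
    using sums_scaleR_right[OF flow_sums[of t M x], of c]
    by (simp add: linear_scale[OF linear_iterated_matrix] mult.commute)
  then show "flow M t (c *\<^sub>R x) = c *\<^sub>R flow M t x"
    using sums_unique2[OF flow_sums] by blast
qed

lemma flow_matrix_commute: "flow M t (M *v z) = M *v flow M t z"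
  by (rule flow_intertwines[symmetric]) auto

text \<open>Moves the flow onto the test vector, so that time derivatives can be taken on a
  trajectory starting from the fixed vector \<open>w\<close>.\<close>

lemma flow_adjoint: "w \<bullet> flow M t z = flow (transpose M) t w \<bullet> (z :: real ^ 'n::finite)"
proof -
  have eq: "w \<bullet> (((*v) M) ^^ k) z = (((*v) (transpose M)) ^^ k) w \<bullet> z" for k
  proof (induction k arbitrary: w)
    case (Suc k)
    have "w \<bullet> (((*v) M) ^^ Suc k) z = (transpose M *v w) \<bullet> (((*v) M) ^^ k) z"
      by (simp add: dot_lmul_matrix[symmetric] transpose_matrix_vector)
    also have "\<dots> = (((*v) (transpose M)) ^^ k) (transpose M *v w) \<bullet> z" by (rule Suc)
    finally show ?case by (simp only: funpow_Suc_right o_apply)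
  qed simp
  show ?thesis
    by (rule sums_unique2[OF flow_bounded_linear_sums[OF bounded_linear_inner_right[of w], of t M z, unfolded eq]
      flow_bounded_linear_sums[OF bounded_linear_inner_left[of z], of t "transpose M" w]])
qed

text \<open>Testing against \<open>w\<close> leaves a scalar power series in \<open>t\<close>, to
  which termwise differentiation applies.\<close>

lemma flow_inner_DERIV:
  fixes M :: "real ^ 'n ^ 'n::finite"
  shows "((\<lambda>t. w \<bullet> flow M t z) has_real_derivative (w \<bullet> flow M t (M *v z))) (at t within S)"
proof -
  define c where "c = (\<lambda>k. (w \<bullet> (((*v) M) ^^ k) z) / fact k)"
  have sums: "(\<lambda>k. c k * t ^ k) sums (w \<bullet> flow M t z)" for t
    using flow_bounded_linear_sums[OF bounded_linear_inner_right[of w], of t M z]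
    by (simp add: c_def mult.commute)
  have "(\<lambda>k. diffs c k * t ^ k) sums (w \<bullet> flow M t (M *v z))"
    using flow_bounded_linear_sums[OF bounded_linear_inner_right[of w], of t M "M *v z"]
    by (simp add: c_def diffs_def funpow_swap1 mult.commute del: of_nat_Suc)
  then have *: "(\<Sum>k. diffs c k * t ^ k) = w \<bullet> flow M t (M *v z)" by (simp add: sums_iff)
  have "((\<lambda>t. \<Sum>k. c k * t ^ k) has_real_derivative (\<Sum>k. diffs c k * t ^ k)) (at t)"
    by (intro termdiffs_strong_converges_everywhere) (use sums in \<open>auto simp: sums_iff\<close>)
  moreover have "(\<lambda>t. \<Sum>k. c k * t ^ k) = (\<lambda>t. w \<bullet> flow M t z)"
    using sums by (auto simp: sums_iff fun_eq_iff)
  ultimately show ?thesis using * by (auto intro: has_field_derivative_at_within)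
qed

lemma flow_has_vector_derivative:
  fixes M :: "real ^ 'n ^ 'n::finite"
  shows "((\<lambda>t. flow M t z) has_vector_derivative (M *v flow M t z)) (at t within S)"
  unfolding has_vector_derivative_def
proof (rule has_derivative_componentwise_within[THEN iffD2], rule ballI)
  fix i :: "real ^ 'n" assume "i \<in> Basis"
  show "((\<lambda>t. flow M t z \<bullet> i) has_derivative (\<lambda>h. h *\<^sub>R (M *v flow M t z) \<bullet> i)) (at t within S)"
  proof (rule has_derivative_eq_rhs)
    show "((\<lambda>t. flow M t z \<bullet> i) has_derivative (*) (i \<bullet> flow M t (M *v z))) (at t within S)"
      using flow_inner_DERIV[of i M z t S] unfolding has_field_derivative_def
      by (subst inner_commute)
    show "(*) (i \<bullet> flow M t (M *v z)) = (\<lambda>h. h *\<^sub>R (M *v flow M t z) \<bullet> i)"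
    proof
      fix h
      show "(i \<bullet> flow M t (M *v z)) * h = h *\<^sub>R (M *v flow M t z) \<bullet> i"
        by (subst flow_matrix_commute, subst inner_commute, simp)
    qed
  qed
qed

lemma flow_in_subspace:
  fixes M :: "real ^ 'n ^ 'n::finite"
  assumes S: "subspace S" and inv: "\<And>z. z \<in> S \<Longrightarrow> M *v z \<in> S" and z: "z \<in> S"
  shows "flow M t z \<in> S"
proof (rule closed_sequentially[OF closed_subspace[OF S]])
  have k: "(((*v) M) ^^ k) z \<in> S" for k by (induction k) (auto simp: z inv)
  show "(\<Sum>k<n. (t ^ k / fact k) *\<^sub>R (((*v) M) ^^ k) z) \<in> S" for n
    by (intro subspace_sum subspace_scale S k)
  show "(\<lambda>n. \<Sum>k<n. (t ^ k / fact k) *\<^sub>R (((*v) M) ^^ k) z) \<longlonglongrightarrow> flow M t z"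
    using flow_sums[of t M z] by (simp add: sums_def)
qed

text \<open>Expanding \<open>x s\<close> in the standard basis leaves finitely many trajectories of
  fixed vectors, so continuity in time alone is enough.\<close>

lemma continuous_flow_pair:
  fixes M :: "real ^ 'n ^ 'n::finite"
  assumes "continuous_on S f" "continuous_on S x"
  shows "continuous_on S (\<lambda>s. flow M (f s) (x s))"
proof -
  have *: "continuous_on S (\<lambda>s. flow M (f s) z)" for z
  proof -
    have "continuous_on UNIV (\<lambda>t. flow M t z)"
      by (rule continuous_on_vector_derivative) (rule flow_has_vector_derivative)
    then show ?thesis using continuous_on_compose2[OF _ assms(1)] by blast
  qed
  have "flow M (f s) (x s) = (\<Sum>i\<in>UNIV. (x s $ i) *\<^sub>R flow M (f s) (axis i 1))" for s
    by (subst basis_expansion[of "x s", symmetric])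
       (simp add: linear_sum[OF linear_flow] linear_scale[OF linear_flow] scalar_mult_eq_scaleR)
  then show ?thesis using assms(2) * by (auto intro!: continuous_intros)
qed

text \<open>The Duhamel formula after integration by parts, tested against \<open>w\<close>. A noise
  path is only continuous, hence so is \<open>x\<close>; but \<open>y = x - b\<close> has derivative
  \<open>M *v x\<close>, and the formula is the fundamental theorem of calculus for the product of
  \<open>y\<close> with an adjoint trajectory.\<close>

lemma linear_equation_duhamel:
  fixes M :: "real ^ 'n ^ 'n::finite"
  assumes t: "0 \<le> t"
    and x: "continuous_on {0..t} x" and b: "continuous_on {0..t} b"
    and eq: "\<And>s. s \<in> {0..t} \<Longrightarrow> ((\<lambda>r. M *v x r) has_integral (x s - z - b s)) {0..s}"
  shows "((\<lambda>s. w \<bullet> flow M (t - s) (M *v b s)) has_integral (w \<bullet> (x t - b t - flow M t z))) {0..t}"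
proof -
  define y where "y = (\<lambda>s. x s - b s)"
  have y: "(y has_vector_derivative (M *v x s)) (at s within {0..t})" if "s \<in> {0..t}" for s
  proof -
    have c: "continuous_on {0..t} (\<lambda>s. M *v x s)"
      by (intro linear_continuous_on_compose[OF x]) auto
    have "((\<lambda>u. integral {0..u} (\<lambda>s. M *v x s)) has_vector_derivative (M *v x s)) (at s within {0..t})"
      using integral_has_vector_derivative[OF c that] .
    then have "((\<lambda>u. z + integral {0..u} (\<lambda>s. M *v x s)) has_vector_derivative (M *v x s)) (at s within {0..t})"
      by (auto intro!: derivative_eq_intros)
    then show ?thesis
      by (rule has_vector_derivative_transform[OF that, rotated])
         (use integral_unique[OF eq] in \<open>auto simp: y_def\<close>)
  qed
  \<comment> \<open>The backward adjoint trajectory. Its derivative cancels the unknown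
    \<open>x\<close> in the derivative of \<open>\<psi> s \<bullet> y s\<close>, which leaves only
    \<open>b\<close>.\<close>
  define \<psi> where "\<psi> = (\<lambda>s. flow (transpose M) (t - s) w)"
  have "((\<lambda>s. flow (transpose M) (t - s) w) has_vector_derivative
      (-1) *\<^sub>R (transpose M *v \<psi> s)) (at s within {0..t})" for s
    unfolding \<psi>_def
    by (rule vector_diff_chain_within[of "\<lambda>s. t - s" "-1" s "{0..t}" "\<lambda>s. flow (transpose M) s w", unfolded o_def])
       (auto intro!: derivative_eq_intros flow_has_vector_derivative simp del: transpose_matrix_vector)
  then have psi: "(\<psi> has_vector_derivative (- (transpose M *v \<psi> s))) (at s within {0..t})" for s
    by (simp add: \<psi>_def)
  have "((\<lambda>s. \<psi> s \<bullet> y s) has_vector_derivative (\<psi> s \<bullet> (M *v b s))) (at s within {0..t})"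
    if s: "s \<in> {0..t}" for s
  proof -
    have e: "\<psi> s \<bullet> (M *v x s) + (- (transpose M *v \<psi> s)) \<bullet> y s = \<psi> s \<bullet> (M *v b s)"
      by (simp add: y_def dot_lmul_matrix[symmetric] transpose_matrix_vector inner_diff_right
          matrix_vector_mult_diff_distrib)
    have "((\<lambda>s. \<psi> s \<bullet> y s) has_derivative (\<lambda>h. \<psi> s \<bullet> (h *\<^sub>R (M *v x s)) + (h *\<^sub>R (- (transpose M *v \<psi> s))) \<bullet> y s))
       (at s within {0..t})"
      using has_derivative_inner[OF psi[unfolded has_vector_derivative_def] y[OF s, unfolded has_vector_derivative_def]] .
    then show ?thesis
      unfolding has_vector_derivative_def e[symmetric]
      by (rule back_subst[of "\<lambda>f. (_ has_derivative f) _"]) (auto simp: algebra_simps)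
  qed
  then have "((\<lambda>s. \<psi> s \<bullet> (M *v b s)) has_integral (\<psi> t \<bullet> y t - \<psi> 0 \<bullet> y 0)) {0..t}"
    by (intro fundamental_theorem_of_calculus t) auto
  \<comment> \<open>At time 0 the equation is an integral over a single point, so it fixes
    \<open>x 0 - b 0\<close> even though \<open>b 0\<close> is not assumed to be 0.\<close>
  moreover have y0: "y 0 = z"
  proof -
    have "((\<lambda>r. M *v x r) has_integral (x 0 - z - b 0)) {0}" using eq[of 0] t by simp
    then have "x 0 - z - b 0 = 0" using has_integral_refl(2) has_integral_unique by blast
    then show ?thesis by (simp add: y_def algebra_simps)
  qed
  ultimately show ?thesis
    unfolding y0 by (simp add: \<psi>_def flow_adjoint[symmetric] y_def inner_diff_right)
qed

section \<open>The harmonic network as a linear equation\<close>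

lemma sum_UNIV_Plus:
  fixes f :: "'a::finite + 'b::finite \<Rightarrow> 'c::comm_monoid_add"
  shows "sum f UNIV = (\<Sum>i\<in>UNIV. f (Inl i)) + (\<Sum>i\<in>UNIV. f (Inr i))"
  by (simp add: UNIV_Plus_UNIV[symmetric] sum.Plus del: UNIV_Plus_UNIV)

lemma sum_Collect_UNIV:
  fixes f :: "'a::finite \<Rightarrow> 'c::comm_monoid_add"
  shows "(\<Sum>j | P j. f j) = (\<Sum>j\<in>UNIV. if P j then f j else 0)"
  using sum.inter_filter[of UNIV f P] by simp

abbreviation stiffness_matrix :: "('v::finite \<Rightarrow> 'v \<Rightarrow> bool) \<Rightarrow> real ^ 'v ^ 'v" where
  "stiffness_matrix adj \<equiv> mat 1 + graph_laplacian adj"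

definition phase_point :: "real ^ 'v \<Rightarrow> real ^ 'v \<Rightarrow> real ^ ('v + 'v::finite)" where
  "phase_point q p = (\<chi> c. case c of Inl i \<Rightarrow> q $ i | Inr i \<Rightarrow> p $ i)"

definition positions :: "real ^ ('v + 'v::finite) \<Rightarrow> real ^ 'v" where
  "positions z = (\<chi> i. z $ Inl i)"

definition momenta :: "real ^ ('v + 'v::finite) \<Rightarrow> real ^ 'v" where
  "momenta z = (\<chi> i. z $ Inr i)"

lemma phase_point_simps [simp]:
  "phase_point q p $ Inl i = q $ i" "phase_point q p $ Inr i = p $ i"
  "positions (phase_point q p) = q" "momenta (phase_point q p) = p"
  "phase_point (positions z) (momenta z) = z"
  "positions z $ i = z $ Inl i" "momenta z $ i = z $ Inr i"
  by (auto simp: phase_point_def positions_def momenta_def vec_eq_iff split: sum.split)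

lemma linear_positions: "linear positions" and linear_momenta: "linear momenta"
  by (auto simp: linear_iff vec_eq_iff)

lemma phase_eq_iff: "z = z' \<longleftrightarrow> positions z = positions z' \<and> momenta z = momenta z'"
  by (metis phase_point_simps(5))

lemma stiffness_apply:
  fixes q :: "real ^ 'v::finite"
  assumes sym: "symp adj"
  shows "(stiffness_matrix adj *v q) $ i = q $ i + (\<Sum>j | adj j i. q $ i - q $ j)"
proof -
  have a: "graph_laplacian adj $ i $ j = (if j = i then real (card {k. adj k i}) else 0) - (if adj j i then 1 else 0)" for j
    using sympD[OF sym, of i j] sympD[OF sym, of j i] by (auto simp: graph_laplacian_def)
  have "(graph_laplacian adj *v q) $ i
      = (\<Sum>j\<in>UNIV. (if j = i then real (card {k. adj k i}) * q $ j else 0)) - (\<Sum>j\<in>UNIV. (if adj j i then q $ j else 0))"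
    unfolding sum_subtractf[symmetric]
    unfolding matrix_vector_mult_def by (auto simp: a algebra_simps intro!: sum.cong)
  also have "\<dots> = (\<Sum>j | adj j i. q $ i - q $ j)"
    by (simp add: sum_Collect_UNIV[symmetric] sum_subtractf)
  finally show ?thesis by (simp add: matrix_vector_mult_add_rdistrib)
qed

text \<open>Discrete Green formula. Exchanging the two summation indices and averaging makes the sum
  symmetric; every edge then occurs twice, hence the factor 1/2. Symmetry and positivity of the
  stiffness matrix, and the gradient of the Hamiltonian, are read off from it.\<close>

lemma stiffness_inner:
  fixes q r :: "real ^ 'v::finite"
  assumes sym: "symp adj"
  shows "r \<bullet> (stiffness_matrix adj *v q)
    = r \<bullet> q + (\<Sum>i\<in>UNIV. \<Sum>j\<in>UNIV. if adj j i then (r $ i - r $ j) * (q $ i - q $ j) else 0) / 2"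
proof -
  have a: "adj i j \<longleftrightarrow> adj j i" for i j using sympD[OF sym] by blast
  define S where "S = (\<Sum>i\<in>UNIV. \<Sum>j\<in>UNIV. if adj j i then r $ i * (q $ i - q $ j) else 0)"
  have "S = (\<Sum>j\<in>UNIV. \<Sum>i\<in>UNIV. if adj j i then r $ i * (q $ i - q $ j) else 0)"
    unfolding S_def by (rule sum.swap)
  also have "\<dots> = (\<Sum>i\<in>UNIV. \<Sum>j\<in>UNIV. if adj j i then r $ j * (q $ j - q $ i) else 0)"
    by (simp add: a)
  finally have S2: "S = \<dots>" .
  have "2 * S = (\<Sum>i\<in>UNIV. \<Sum>j\<in>UNIV. if adj j i then (r $ i - r $ j) * (q $ i - q $ j) else 0)"
  proof -
    have "2 * S = S + (\<Sum>i\<in>UNIV. \<Sum>j\<in>UNIV. if adj j i then r $ j * (q $ j - q $ i) else 0)"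
      using S2 by simp
    also have "\<dots> = (\<Sum>i\<in>UNIV. \<Sum>j\<in>UNIV. if adj j i then (r $ i - r $ j) * (q $ i - q $ j) else 0)"
      unfolding S_def sum.distrib[symmetric] by (intro sum.cong refl) (auto simp: algebra_simps)
    finally show ?thesis .
  qed
  moreover have "r \<bullet> (stiffness_matrix adj *v q) = r \<bullet> q + S"
  proof -
    have "r \<bullet> (stiffness_matrix adj *v q) = (\<Sum>i\<in>UNIV. r $ i * (q $ i + (\<Sum>j | adj j i. q $ i - q $ j)))"
      by (simp add: inner_vec_def stiffness_apply[OF sym])
    also have "\<dots> = r \<bullet> q + S"
      unfolding S_def
      by (simp add: inner_vec_def distrib_left sum.distrib sum_distrib_left sum_Collect_UNIV if_distrib cong: if_cong)
    finally show ?thesis .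
  qed
  ultimately show ?thesis by simp
qed

lemma drift_matrix_apply:
  fixes z :: "real ^ ('v + 'v::finite)"
  shows "drift_matrix adj D *v z = phase_point (momenta z)
     (- (stiffness_matrix adj *v positions z) - (\<chi> i. indicator D i * momenta z $ i))"
proof -
  have "(drift_matrix adj D *v z) $ Inl i = momenta z $ i" for i
    by (simp add: drift_matrix_def block_matrix_def matrix_vector_mult_def sum_UNIV_Plus mat_def
        if_distrib[of "\<lambda>x. x * _"] cong: if_cong)
  moreover have "(drift_matrix adj D *v z) $ Inr i
      = - (stiffness_matrix adj *v positions z) $ i - indicator D i * momenta z $ i" for i
    by (simp add: drift_matrix_def block_matrix_def matrix_vector_mult_def sum_UNIV_Plus
        sum_negf[symmetric] if_distrib[of "\<lambda>x. x * _"] if_distrib[of "\<lambda>x. _ * x"]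
        if_distrib[of uminus] algebra_simps cong: if_cong)
  ultimately show ?thesis
    by (auto simp: vec_eq_iff phase_point_def split: sum.split)
qed

text \<open>Differentiating the quadratic potential in the direction of a unit vector gives the
  bilinear form of the Green formula, evaluated at that unit vector and the positions.\<close>

lemma partial_deriv_harmonic_hamiltonian:
  fixes z :: "real ^ ('v + 'v::finite)"
  assumes sym: "symp adj"
  shows "partial_deriv (Inl i) (hamiltonian adj (\<lambda>x. x\<^sup>2 / 2) (\<lambda>x. x\<^sup>2 / 2)) z
     = (stiffness_matrix adj *v positions z) $ i"
proof -
  define d :: "'v \<Rightarrow> real" where "d k = (if k = i then 1 else 0)" for k
  define q where "q = positions z"
  have e: "position (z + h *\<^sub>R axis (Inl i) 1) k = q $ k + h * d k"
    "momentum (z + h *\<^sub>R axis (Inl i) 1) k = z $ Inr k" for h k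
    by (auto simp: axis_def d_def q_def)
  have "((\<lambda>h. hamiltonian adj (\<lambda>x. x\<^sup>2 / 2) (\<lambda>x. x\<^sup>2 / 2) (z + h *\<^sub>R axis (Inl i) 1))
      has_real_derivative (\<Sum>k\<in>UNIV. q $ k * d k + (\<Sum>j | adj j k. (q $ k - q $ j) * (d k - d j)) / 2)) (at 0)"  (is "(_ has_real_derivative ?R) _")
    unfolding hamiltonian_def e
    by (auto intro!: derivative_eq_intros sum.cong simp: field_simps)
  then have "partial_deriv (Inl i) (hamiltonian adj (\<lambda>x. x\<^sup>2 / 2) (\<lambda>x. x\<^sup>2 / 2)) z
      = (\<Sum>k\<in>UNIV. q $ k * d k + (\<Sum>j | adj j k. (q $ k - q $ j) * (d k - d j)) / 2)"
    unfolding partial_deriv_def by (rule DERIV_imp_deriv)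
  also have "\<dots> = axis i 1 \<bullet> (stiffness_matrix adj *v q)"
  proof -
    have axis: "axis i 1 $ k = d k" for k by (simp add: axis_def d_def)
    then show ?thesis
      using stiffness_inner[of adj "axis i 1" q, OF sym, unfolded axis]
      by (simp add: inner_vec_def sum.distrib sum_divide_distrib sum_Collect_UNIV mult.commute)
  qed
  finally show ?thesis by (simp add: inner_axis' q_def)
qed

definition noise_path :: "'v::finite set \<Rightarrow> ('v \<Rightarrow> real) \<Rightarrow> ('v \<Rightarrow> real \<Rightarrow> 'w \<Rightarrow> real) \<Rightarrow> 'w \<Rightarrow> real \<Rightarrow> real ^ ('v + 'v)" where
  "noise_path bdry T B \<omega> t = (\<Sum>i\<in>bdry. (sqrt (2 * T i) * B i t \<omega>) *\<^sub>R axis (Inr i) 1)"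

lemma noise_path_nth:
  "noise_path bdry T B \<omega> t $ Inl i = 0"
  "noise_path bdry T B \<omega> t $ Inr i = sqrt (2 * T i) * indicator bdry i * B i t \<omega>"
proof -
  show "noise_path bdry T B \<omega> t $ Inl i = 0" by (simp add: noise_path_def axis_def)
  have "noise_path bdry T B \<omega> t $ Inr i = (\<Sum>j\<in>bdry. if j = i then sqrt (2 * T j) * B j t \<omega> else 0)"
    unfolding noise_path_def by (simp add: axis_def if_distrib[of "\<lambda>x. _ * x"] eq_commute cong: if_cong)
  then show "noise_path bdry T B \<omega> t $ Inr i = sqrt (2 * T i) * indicator bdry i * B i t \<omega>"
    by (auto simp: indicator_def)
qed

lemma harmonic_network_solution:
  fixes z :: "real ^ ('v + 'v::finite)"
  assumes sym: "symp adj"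
    and sol: "network_solution adj (\<lambda>x. x\<^sup>2 / 2) (\<lambda>x. x\<^sup>2 / 2) D bdry T W B z Z"
  shows "AE \<omega> in W. continuous_on {0..} (\<lambda>t. Z t \<omega>) \<and> (\<forall>t\<ge>0.
    ((\<lambda>s. drift_matrix adj D *v Z s \<omega>) has_integral (Z t \<omega> - z - noise_path bdry T B \<omega> t)) {0..t})"
proof -
  have *: "(\<lambda>s. (drift_matrix adj D *v Z s \<omega>) $ Inl i) = (\<lambda>s. momentum (Z s \<omega>) i)"
    "(\<lambda>s. (drift_matrix adj D *v Z s \<omega>) $ Inr i) = (\<lambda>s. - partial_deriv (Inl i)
       (hamiltonian adj (\<lambda>x. x\<^sup>2 / 2) (\<lambda>x. x\<^sup>2 / 2)) (Z s \<omega>) - momentum (Z s \<omega>) i * indicator D i)" for \<omega> i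
    by (auto simp: drift_matrix_apply partial_deriv_harmonic_hamiltonian[OF sym])
  have comp: "(f has_integral y) S" if "\<And>i. ((\<lambda>s. f s $ Inl i) has_integral y $ Inl i) S"
    "\<And>i. ((\<lambda>s. f s $ Inr i) has_integral y $ Inr i) S" for f :: "real \<Rightarrow> real ^ ('v + 'v)" and y S
  proof (subst has_integral_componentwise_iff, rule ballI)
    fix b :: "real ^ ('v + 'v)" assume "b \<in> Basis"
    then obtain c where "b = axis c 1" by (auto simp: Basis_vec_def)
    then show "((\<lambda>s. f s \<bullet> b) has_integral y \<bullet> b) S"
      using that by (cases c) (auto simp: inner_axis)
  qed
  show ?thesis
    using sol unfolding network_solution_def
    apply (elim conjE)
    apply (erule AE_mp)
    apply (rule AE_I2)
    apply (auto intro!: comp simp: * noise_path_nth)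
    done
qed

section \<open>Energy and undamped modes\<close>

text \<open>Differentiating k times on the open interval replaces \<open>z\<close> by its k-th
  iterate; letting t decrease to 0 then removes the flow. The interval is open because the
  applications control derivatives only at interior times.\<close>

lemma flow_inner_eq_0_imp_iterates:
  fixes M :: "real ^ 'n ^ 'n::finite"
  assumes zero: "\<And>t. 0 < t \<Longrightarrow> t < 1 \<Longrightarrow> w \<bullet> flow M t z = 0"
  shows "w \<bullet> (((*v) M) ^^ k) z = 0"
proof -
  have k: "w \<bullet> flow M t ((((*v) M) ^^ k) z) = 0" if "0 < t" "t < 1" for t
    using that
  proof (induction k arbitrary: t)
    case (Suc k)
    have "((\<lambda>t. 0) has_real_derivative (w \<bullet> flow M t (M *v (((*v) M) ^^ k) z))) (at t)"
      by (rule has_field_derivative_transform_within_open[OF flow_inner_DERIV, of "{0<..<1}"])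
         (use Suc in auto)
    then show ?case using DERIV_unique[OF _ DERIV_const] by fastforce
  qed (simp add: zero)
  have "((\<lambda>t. w \<bullet> flow M t ((((*v) M) ^^ k) z)) \<longlongrightarrow> w \<bullet> flow M 0 ((((*v) M) ^^ k) z)) (at 0 within {0<..<1})"
    using DERIV_isCont[OF flow_inner_DERIV[of w M "(((*v) M) ^^ k) z" 0 UNIV]]
    by (auto simp: isCont_def intro: tendsto_within_subset)
  moreover have "((\<lambda>t. w \<bullet> flow M t ((((*v) M) ^^ k) z)) \<longlongrightarrow> 0) (at 0 within {0<..<1})"
    by (rule tendsto_eventually) (auto simp: eventually_at_filter k)
  moreover have "at (0::real) within {0<..<1} \<noteq> bot"
    by (simp add: at_within_eq_bot_iff)
  ultimately show ?thesis using tendsto_unique by fastforce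
qed

text \<open>As a function of the second time, the left side solves the homogeneous equation started
  at \<open>flow M s z\<close>; the Duhamel formula with zero forcing identifies it with the right
  side.\<close>

lemma flow_add:
  fixes M :: "real ^ 'n ^ 'n::finite"
  assumes "0 \<le> t"
  shows "flow M (s + t) z = flow M t (flow M s z)"
proof -
  have "((\<lambda>r. M *v flow M (s + r) z) has_integral (flow M (s + u) z - flow M s z - 0)) {0..u}"
    if "u \<in> {0..t}" for u
  proof -
    have "((\<lambda>r. flow M (s + r) z) has_vector_derivative 1 *\<^sub>R (M *v flow M (s + r) z)) (at r within {0..u})" for r
      by (rule vector_diff_chain_within[of "\<lambda>r. s + r" 1 r "{0..u}" "\<lambda>r. flow M r z", unfolded o_def])
         (auto intro!: derivative_eq_intros flow_has_vector_derivative)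
    then show ?thesis
      using fundamental_theorem_of_calculus[of 0 u "\<lambda>r. flow M (s + r) z" "\<lambda>r. M *v flow M (s + r) z"] that
      by auto
  qed
  then have "((\<lambda>r. w \<bullet> flow M (t - r) (M *v 0)) has_integral (w \<bullet> (flow M (s + t) z - 0 - flow M t (flow M s z)))) {0..t}" for w
    by (intro linear_equation_duhamel[OF assms, where b = "\<lambda>_. 0"] continuous_flow_pair continuous_intros) auto
  then have "w \<bullet> (flow M (s + t) z - flow M t (flow M s z)) = 0" for w
    using has_integral_unique[OF _ has_integral_0] by (fastforce simp: linear_0[OF linear_flow])
  from this[of "flow M (s + t) z - flow M t (flow M s z)"] show ?thesis by simp
qed

text \<open>The orthogonal projection, written in an orthonormal basis. Its symmetry is what later
  makes it commute with a symmetric matrix that preserves \<open>P\<close>.\<close>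

lemma subspace_symmetric_projection:
  fixes P :: "'a::euclidean_space set"
  assumes P: "subspace P"
  shows "\<exists>\<pi>. linear \<pi> \<and> (\<forall>x. \<pi> x \<in> P) \<and> (\<forall>p\<in>P. \<pi> p = p) \<and> (\<forall>x y. x \<bullet> \<pi> y = \<pi> x \<bullet> y)"
proof -
  obtain B where B: "B \<subseteq> P" "pairwise orthogonal B" "\<And>x. x \<in> B \<Longrightarrow> norm x = 1"
    "independent B" "span B = P"
    using orthonormal_basis_subspace[OF P] by metis
  have fin: "finite B" using B(4) by (simp add: independent_bound)
  define \<pi> where "\<pi> x = (\<Sum>b\<in>B. (b \<bullet> x) *\<^sub>R b)" for x
  have inP: "\<pi> x \<in> P" for x
    unfolding \<pi>_def by (intro subspace_sum subspace_scale P) (use B(1) in auto)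
  have lin: "linear \<pi>"
    by (auto simp: linear_iff \<pi>_def inner_add_right scaleR_add_left sum.distrib scaleR_sum_right)
  have sym: "x \<bullet> \<pi> y = \<pi> x \<bullet> y" for x y
    by (auto simp: \<pi>_def inner_sum_left inner_sum_right inner_commute intro!: sum.cong)
  have "\<pi> p = p" if "p \<in> P" for p
  proof -
    have b: "orthogonal (p - \<pi> p) b" if "b \<in> B" for b
    proof -
      have "b \<bullet> \<pi> p = (\<Sum>c\<in>B. if c = b then b \<bullet> p else 0)"
        unfolding \<pi>_def inner_sum_right
      proof (rule sum.cong[OF refl])
        fix c assume "c \<in> B"
        then show "b \<bullet> (c \<bullet> p) *\<^sub>R c = (if c = b then b \<bullet> p else 0)"
          using B(2) B(3)[of b] that by (auto simp: pairwise_def orthogonal_def norm_eq_1)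
      qed
      then show ?thesis using that fin
        by (simp add: orthogonal_def inner_diff_left inner_diff_right inner_commute)
    qed
    have "p - \<pi> p \<in> span B" using B(5) that inP by (simp add: subspace_diff[OF P])
    then have "orthogonal (p - \<pi> p) (p - \<pi> p)"
      using b orthogonal_to_span by blast
    then show ?thesis by (simp add: orthogonal_def)
  qed
  then show ?thesis
    by (intro exI[of _ \<pi>] conjI allI ballI lin inP sym)
qed

lemma controllable_space_invariant:
  assumes "z \<in> controllable_space M I"
  shows "M *v z \<in> controllable_space M I"
proof -
  let ?S = "{(((*v) M) ^^ k) (axis (Inr i) 1) | i k. i \<in> I}"
  have "(*v) M ` ?S \<subseteq> ?S"
  proof
    fix y assume "y \<in> (*v) M ` ?S"
    then obtain i k where "i \<in> I" "y = (((*v) M) ^^ (Suc k)) (axis (Inr i) 1)" by auto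
    then show "y \<in> ?S" by blast
  qed
  then have "span ((*v) M ` ?S) \<subseteq> span ?S" by (rule span_mono)
  then have "(*v) M ` span ?S \<subseteq> span ?S"
    by (subst (asm) linear_span_image[OF matrix_vector_mul_linear[of M]])
  then show ?thesis using assms unfolding controllable_space_def by blast
qed

lemma noise_path_in_controllable_space: "noise_path bdry T B \<omega> t \<in> controllable_space M bdry"
  unfolding noise_path_def
proof (intro subspace_sum subspace_scale)
  fix i assume "i \<in> bdry"
  then show "axis (Inr i) 1 \<in> controllable_space M bdry"
    unfolding controllable_space_def by (intro span_base CollectI exI[of _ i] exI[of _ 0]) auto
qed (auto simp: controllable_space_def)

text \<open>For symmetric \<open>adj\<close> this is twice the harmonic Hamiltonian.\<close>

definition energy :: "('v \<Rightarrow> 'v \<Rightarrow> bool) \<Rightarrow> real ^ ('v + 'v::finite) \<Rightarrow> real" where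
  "energy adj z = positions z \<bullet> (stiffness_matrix adj *v positions z) + momenta z \<bullet> momenta z"

text \<open>The momenta of the states whose orbit never moves a damped vertex. Up to the invertibility of the
  stiffness matrix this is also the space of their positions.\<close>

definition undamped_momenta :: "('v \<Rightarrow> 'v \<Rightarrow> bool) \<Rightarrow> 'v set \<Rightarrow> (real ^ 'v::finite) set" where
  "undamped_momenta adj D =
     momenta ` {z. \<forall>k. \<forall>i\<in>D. ((((*v) (drift_matrix adj D)) ^^ k) z) $ Inr i = 0}"

section \<open>Dissipation of energy and the projection onto undamped modes\<close>

context
  fixes adj :: "'v::finite \<Rightarrow> 'v \<Rightarrow> bool" and D :: "'v set"
  assumes sym: "symp adj"
begin

lemma stiffness_symmetric:
  fixes q r :: "real ^ 'v"
  shows "r \<bullet> (stiffness_matrix adj *v q) = (stiffness_matrix adj *v r) \<bullet> q"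
  unfolding stiffness_inner[OF sym] inner_commute[of "stiffness_matrix adj *v r" q]
  by (simp add: inner_commute mult.commute cong: if_cong)

lemma stiffness_ge: "q \<bullet> q \<le> q \<bullet> (stiffness_matrix adj *v (q :: real ^ 'v))"
  unfolding stiffness_inner[OF sym] by (auto intro!: sum_nonneg divide_nonneg_nonneg)

lemma energy_ge: "(norm z)\<^sup>2 \<le> energy adj (z :: real ^ ('v + 'v))"
proof -
  have "(norm z)\<^sup>2 = positions z \<bullet> positions z + momenta z \<bullet> momenta z"
    by (simp add: power2_norm_eq_inner inner_vec_def sum_UNIV_Plus)
  then show ?thesis using stiffness_ge[of "positions z"] by (simp add: energy_def)
qed

lemma energy_scaleR: "energy adj (c *\<^sub>R z) = c\<^sup>2 * energy adj (z :: real ^ ('v + 'v))"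
  by (simp add: energy_def linear_scale[OF linear_positions] linear_scale[OF linear_momenta]
      matrix_vector_mult_scaleR power2_eq_square algebra_simps)

text \<open>The exchange between potential and kinetic energy cancels by symmetry of the stiffness
  matrix, so friction at the vertices of \<open>D\<close> is all that remains.\<close>

lemma energy_flow_DERIV:
  "((\<lambda>t. energy adj (flow (drift_matrix adj D) t z)) has_real_derivative
     - 2 * (\<Sum>i\<in>D. (flow (drift_matrix adj D) t z $ Inr i)\<^sup>2)) (at t)"
proof -
  let ?M = "drift_matrix adj D" and ?G = "stiffness_matrix adj"
  define q where "q t = positions (flow ?M t z)" for t
  define p where "p t = momenta (flow ?M t z)" for t
  define d where "d t = (\<chi> i. indicator D i * p t $ i)" for t
  have q: "(q has_vector_derivative p t) (at t)" for t
    unfolding q_def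
    using bounded_linear.has_vector_derivative[OF linear_conv_bounded_linear[THEN iffD1, OF linear_positions]
        flow_has_vector_derivative[of ?M z t UNIV]]
    by (simp add: drift_matrix_apply p_def)
  have p: "(p has_vector_derivative (- (?G *v q t) - d t)) (at t)" for t
    unfolding p_def
    using bounded_linear.has_vector_derivative[OF linear_conv_bounded_linear[THEN iffD1, OF linear_momenta]
        flow_has_vector_derivative[of ?M z t UNIV]]
    by (simp add: drift_matrix_apply p_def q_def d_def)
  have Gq: "((\<lambda>t. ?G *v q t) has_vector_derivative (?G *v p t)) (at t)"
    by (rule bounded_linear.has_vector_derivative[OF _ q]) simp
  have "((\<lambda>t. q t \<bullet> (?G *v q t) + p t \<bullet> p t) has_derivative
      (\<lambda>h. (q t \<bullet> (h *\<^sub>R (?G *v p t)) + (h *\<^sub>R p t) \<bullet> (?G *v q t))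
         + (p t \<bullet> (h *\<^sub>R (- (?G *v q t) - d t)) + (h *\<^sub>R (- (?G *v q t) - d t)) \<bullet> p t))) (at t)"
    using q[of t] p[of t] Gq unfolding has_vector_derivative_def
    by (intro has_derivative_add has_derivative_inner)
  moreover have "q t \<bullet> (h *\<^sub>R (?G *v p t)) + (h *\<^sub>R p t) \<bullet> (?G *v q t)
         + (p t \<bullet> (h *\<^sub>R (- (?G *v q t) - d t)) + (h *\<^sub>R (- (?G *v q t) - d t)) \<bullet> p t)
       = (- 2 * (p t \<bullet> d t)) * h" for h
    using stiffness_symmetric[of "q t" "p t"]
    by (simp add: inner_diff_left inner_diff_right inner_commute algebra_simps)
  moreover have "p t \<bullet> d t = (\<Sum>i\<in>D. (flow ?M t z $ Inr i)\<^sup>2)"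
  proof -
    have "p t \<bullet> d t = (\<Sum>i\<in>UNIV. if i \<in> D then (flow ?M t z $ Inr i)\<^sup>2 else 0)"
      by (auto simp: inner_vec_def d_def p_def power2_eq_square indicator_def intro!: sum.cong)
    then show ?thesis by (simp add: sum_Collect_UNIV[symmetric])
  qed
  ultimately show ?thesis
    unfolding has_field_derivative_def energy_def q_def[symmetric] p_def[symmetric]
    by (elim has_derivative_eq_rhs) (simp only: fun_eq_iff simp_thms)
qed

lemma undamped_momenta_subspace: "subspace (undamped_momenta adj D)"
  unfolding undamped_momenta_def
  by (intro linear_subspace_image linear_momenta)
     (auto simp: subspace_def linear_0[OF linear_iterated_matrix] linear_add[OF linear_iterated_matrix]
       linear_scale[OF linear_iterated_matrix])

lemma undamped_momenta_vanish: "p \<in> undamped_momenta adj D \<Longrightarrow> i \<in> D \<Longrightarrow> p $ i = 0"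
  unfolding undamped_momenta_def by (auto dest: spec[of _ "0::nat"])

text \<open>On these states friction is invisible: the drift acts as the conservative Hamiltonian
  field, and they form an invariant set.\<close>

lemma undamped_drift:
  assumes "\<forall>k. \<forall>i\<in>D. ((((*v) (drift_matrix adj D)) ^^ k) z) $ Inr i = 0"
  shows "drift_matrix adj D *v z = phase_point (momenta z) (- (stiffness_matrix adj *v positions z))"
    and "\<forall>k. \<forall>i\<in>D. ((((*v) (drift_matrix adj D)) ^^ k) (drift_matrix adj D *v z)) $ Inr i = 0"
proof -
  have "(\<chi> i. indicator D i * momenta z $ i) = (0 :: real ^ 'v)"
    using spec[OF assms, of 0] by (auto simp: vec_eq_iff indicator_def)
  then show "drift_matrix adj D *v z = phase_point (momenta z) (- (stiffness_matrix adj *v positions z))"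
    by (simp add: drift_matrix_apply)
  show "\<forall>k. \<forall>i\<in>D. ((((*v) (drift_matrix adj D)) ^^ k) (drift_matrix adj D *v z)) $ Inr i = 0"
    using assms by (metis funpow_Suc_right o_apply)
qed

text \<open>Two applications of the conservative drift send a momentum p to minus the stiffness
  matrix applied to p, without leaving the undamped states.\<close>

lemma undamped_momenta_stiffness:
  assumes "p \<in> undamped_momenta adj D"
  shows "stiffness_matrix adj *v p \<in> undamped_momenta adj D"
proof -
  let ?M = "drift_matrix adj D"
  obtain z where z: "\<forall>k. \<forall>i\<in>D. ((((*v) ?M) ^^ k) z) $ Inr i = 0" "p = momenta z"
    using assms by (auto simp: undamped_momenta_def)
  note z1 = undamped_drift[OF z(1)]
  note z2 = undamped_drift[OF z1(2)]
  have "momenta (?M *v (?M *v z)) \<in> undamped_momenta adj D"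
    using z2(2) unfolding undamped_momenta_def by blast
  then have "- (stiffness_matrix adj *v p) \<in> undamped_momenta adj D"
    by (simp add: z2(1)) (simp add: z1(1) z(2))
  then show ?thesis using subspace_neg[OF undamped_momenta_subspace] by fastforce
qed

text \<open>LaSalle's argument. If no energy is lost over unit time, the friction vanishes
  throughout (0,1), so all iterates of \<open>z\<close> have zero momentum on \<open>D\<close>. Then
  both \<open>z\<close> and its image under the drift are undamped states. Triviality kills both of
  their momenta, the second of which is minus the stiffness matrix applied to the positions;
  positivity of that matrix gives \<open>z = 0\<close>.\<close>

lemma energy_strictly_decreases:
  assumes trivial: "undamped_momenta adj D = {0}" and z: "z \<noteq> 0"
  shows "energy adj (flow (drift_matrix adj D) 1 z) < energy adj z"
proof (rule ccontr)
  let ?M = "drift_matrix adj D"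
  define g where "g t = energy adj (flow ?M t z)" for t
  define g' where "g' t = - 2 * (\<Sum>i\<in>D. (flow ?M t z $ Inr i)\<^sup>2)" for t
  have g: "(g has_real_derivative g' t) (at t)" for t
    unfolding g_def g'_def by (rule energy_flow_DERIV)
  have g'_le: "g' t \<le> 0" for t by (simp add: g'_def sum_nonneg)
  have mono: "g t \<le> g s" if "s \<le> t" for s t
    using DERIV_nonpos_imp_nonincreasing[OF that] g g'_le by blast
  assume "\<not> energy adj (flow ?M 1 z) < energy adj z"
  then have "g 0 \<le> g 1" by (simp add: g_def)
  then have const: "g t = g 0" if "0 \<le> t" "t \<le> 1" for t
    using mono[of 0 t] mono[of t 1] that by linarith
  have "g' t = 0" if "0 < t" "t < 1" for t
  proof (rule DERIV_local_const[OF g])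
    show "0 < min t (1 - t)" using that by simp
    show "\<forall>y. \<bar>t - y\<bar> < min t (1 - t) \<longrightarrow> g t = g y"
    proof (intro allI impI)
      fix y assume "\<bar>t - y\<bar> < min t (1 - t)"
      then have "0 \<le> y" "y \<le> 1" by auto
      then show "g t = g y" using const[of t] const[of y] that by simp
    qed
  qed
  then have "flow ?M t z $ Inr i = 0" if "0 < t" "t < 1" "i \<in> D" for t i
    using that by (auto simp: g'_def sum_nonneg_eq_0_iff)
  then have "axis (Inr i) 1 \<bullet> (((*v) ?M) ^^ k) z = 0" if "i \<in> D" for i k
    using that by (intro flow_inner_eq_0_imp_iterates) (auto simp: inner_axis')
  then have zS: "\<forall>k. \<forall>i\<in>D. ((((*v) ?M) ^^ k) z) $ Inr i = 0" by (simp add: inner_axis')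
  note z1 = undamped_drift[OF zS]
  have p: "momenta z = 0"
    using zS trivial unfolding undamped_momenta_def by blast
  have "momenta (?M *v z) = 0"
    using z1(2) trivial unfolding undamped_momenta_def by blast
  then have "stiffness_matrix adj *v positions z = 0" by (simp add: z1(1))
  then have "positions z = 0" using stiffness_ge[of "positions z"] by (metis inner_eq_zero_iff inner_ge_zero inner_zero_right order_antisym)
  then show False using p z phase_eq_iff[of z 0] by (simp add: linear_0[OF linear_positions] linear_0[OF linear_momenta])
qed

lemma continuous_energy: "continuous_on S (energy adj)"
proof -
  have c: "continuous_on S f" if "linear f" for f :: "real ^ ('v + 'v) \<Rightarrow> real ^ 'v"
    by (rule linear_continuous_on[OF linear_conv_bounded_linear[THEN iffD1, OF that]])
  show ?thesis
    unfolding energy_def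
    by (intro continuous_on_add continuous_on_inner c linear_positions linear_momenta
        linear_compose[OF linear_positions matrix_vector_mul_linear, unfolded o_def])
qed

text \<open>Both energies are quadratic in \<open>z\<close>, so their ratio is determined on the
  unit sphere. By compactness it attains its maximum there, which turns the strict decrease into a
  uniform factor below 1.\<close>

lemma energy_contraction:
  assumes trivial: "undamped_momenta adj D = {0}"
  shows "\<exists>c\<ge>0. c < 1 \<and> (\<forall>z. energy adj (flow (drift_matrix adj D) 1 z) \<le> c * energy adj z)"
proof -
  let ?M = "drift_matrix adj D"
  define f where "f z = energy adj (flow ?M 1 z) / energy adj z" for z
  have pos: "0 < energy adj z" if "z \<noteq> 0" for z :: "real ^ ('v + 'v)"
    using energy_ge[of z] that by (smt (verit) zero_less_power zero_less_norm_iff)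
  have nz: "\<forall>z\<in>sphere (0 :: real ^ ('v + 'v)) 1. energy adj z \<noteq> 0"
  proof
    fix z :: "real ^ ('v + 'v)" assume "z \<in> sphere 0 1"
    then have "z \<noteq> 0" by auto
    then show "energy adj z \<noteq> 0" using pos by force
  qed
  have "continuous_on (sphere 0 1) f"
    unfolding f_def
    by (intro continuous_on_divide continuous_energy continuous_on_compose2[OF continuous_energy[of UNIV]]
        continuous_flow_pair continuous_intros nz) auto
  then obtain x where x: "x \<in> sphere 0 1" "\<And>y. y \<in> sphere 0 1 \<Longrightarrow> f y \<le> f x"
    using continuous_attains_sup[of "sphere (0 :: real ^ ('v + 'v)) 1" f] by auto
  show ?thesis
  proof (intro exI conjI allI)
    show "0 \<le> f x" using energy_ge unfolding f_def
      by (meson divide_nonneg_nonneg order_trans zero_le_power2)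
    have "x \<noteq> 0" using x(1) by auto
    then show "f x < 1" using energy_strictly_decreases[OF trivial] pos by (simp add: f_def)
    show "energy adj (flow ?M 1 z) \<le> f x * energy adj z" for z
    proof (cases "z = 0")
      case False
      have "f ((1 / norm z) *\<^sub>R z) = f z"
        using False by (simp add: f_def linear_scale[OF linear_flow] energy_scaleR)
      moreover have "(1 / norm z) *\<^sub>R z \<in> sphere 0 1" using False by simp
      ultimately have "f z \<le> f x" using x(2) by metis
      then show ?thesis using pos[OF False] by (simp add: f_def field_simps)
    next
      case True
      then show ?thesis by (simp add: linear_0[OF linear_flow] energy_def linear_0[OF linear_positions] linear_0[OF linear_momenta])
    qed
  qed
qed

lemma flow_tendsto_0:
  assumes trivial: "undamped_momenta adj D = {0}"
  shows "(\<lambda>n. flow (drift_matrix adj D) (real n) z) \<longlonglongrightarrow> 0"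
proof -
  let ?M = "drift_matrix adj D"
  obtain c where c: "0 \<le> c" "c < 1" "\<And>z. energy adj (flow ?M 1 z) \<le> c * energy adj z"
    using energy_contraction[OF trivial] by auto
  have "energy adj (flow ?M (real n) z) \<le> c ^ n * energy adj z" for n
  proof (induction n)
    case (Suc n)
    have "energy adj (flow ?M (real (Suc n)) z) = energy adj (flow ?M 1 (flow ?M (real n) z))"
      using flow_add[of 1 ?M "real n" z] by (simp add: add.commute)
    also have "\<dots> \<le> c * energy adj (flow ?M (real n) z)" by (rule c)
    also have "\<dots> \<le> c * (c ^ n * energy adj z)" by (intro mult_left_mono Suc c)
    finally show ?case by simp
  qed simp
  then have le: "(norm (flow ?M (real n) z))\<^sup>2 \<le> c ^ n * energy adj z" for n
    using energy_ge order_trans by blast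
  have "(\<lambda>n. c ^ n * energy adj z) \<longlonglongrightarrow> 0"
    using c by (intro tendsto_mult_left_zero LIMSEQ_realpow_zero) auto
  then have "(\<lambda>n. (norm (flow ?M (real n) z))\<^sup>2) \<longlonglongrightarrow> 0"
    by (rule real_tendsto_sandwich[OF _ _ tendsto_const, rotated 2]) (use le in auto)
  then have "(\<lambda>n. sqrt ((norm (flow ?M (real n) z))\<^sup>2)) \<longlonglongrightarrow> sqrt 0" by (rule tendsto_real_sqrt)
  then show ?thesis by (simp add: tendsto_norm_zero_iff)
qed

text \<open>\<open>\<Phi>\<close> applies the orthogonal projection onto the undamped momenta to
  positions and to momenta. It commutes with the stiffness matrix, which is symmetric and preserves
  that space. The friction term disappears on both sides: vectors of the space vanish on
  \<open>D\<close>, and vectors supported in \<open>D\<close> are orthogonal to it. For the latter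
  reason \<open>\<Phi>\<close> also kills every direction \<open>axis (Inr i) 1\<close> with
  \<open>i\<close> in \<open>D\<close>.\<close>

lemma undamped_projection:
  assumes nontrivial: "undamped_momenta adj D \<noteq> {0}"
  shows "\<exists>\<Phi>. linear \<Phi> \<and> (\<forall>z. \<Phi> (\<Phi> z) = \<Phi> z) \<and>
    (\<forall>z. \<Phi> (drift_matrix adj D *v z) = drift_matrix adj D *v \<Phi> z) \<and>
    (\<forall>z\<in>controllable_space (drift_matrix adj D) D. \<Phi> z = 0) \<and> (\<exists>z. \<Phi> z \<noteq> 0)"
proof -
  let ?P = "undamped_momenta adj D" and ?M = "drift_matrix adj D" and ?G = "stiffness_matrix adj"
  obtain \<pi> where \<pi>: "linear \<pi>" "\<And>x. \<pi> x \<in> ?P" "\<And>p. p \<in> ?P \<Longrightarrow> \<pi> p = p" "\<And>x y. x \<bullet> \<pi> y = \<pi> x \<bullet> y"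
    using subspace_symmetric_projection[OF undamped_momenta_subspace] by auto
  have eqI: "x = y" if "\<And>w. w \<bullet> x = w \<bullet> y" for x y :: "real ^ 'v"
    using vector_eq_ldot[of x y] that by blast
  have comm: "\<pi> (?G *v x) = ?G *v \<pi> x" for x
  proof (rule eqI)
    fix w
    have "w \<bullet> \<pi> (?G *v x) = (?G *v \<pi> w) \<bullet> x"
      by (simp add: \<pi>(4) stiffness_symmetric)
    also have "\<dots> = \<pi> (?G *v \<pi> w) \<bullet> x"
      by (simp add: \<pi>(3)[OF undamped_momenta_stiffness[OF \<pi>(2)]])
    also have "\<dots> = \<pi> w \<bullet> (?G *v \<pi> x)"
      by (simp add: \<pi>(4)[symmetric] stiffness_symmetric)
    also have "\<dots> = w \<bullet> \<pi> (?G *v \<pi> x)" by (simp add: \<pi>(4))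
    finally show "w \<bullet> \<pi> (?G *v x) = w \<bullet> (?G *v \<pi> x)"
      by (simp add: \<pi>(3)[OF undamped_momenta_stiffness[OF \<pi>(2)]])
  qed
  have damped0: "\<pi> x = 0" if "\<And>i. i \<notin> D \<Longrightarrow> x $ i = 0" for x
  proof (rule eqI)
    fix w
    have "\<pi> w \<bullet> x = 0"
      unfolding inner_vec_def using undamped_momenta_vanish[OF \<pi>(2)] that
      by (intro sum.neutral) (metis inner_zero_left inner_zero_right)
    then show "w \<bullet> \<pi> x = w \<bullet> 0" by (simp add: \<pi>(4))
  qed
  define \<Phi> where "\<Phi> z = phase_point (\<pi> (positions z)) (\<pi> (momenta z))" for z
  have lin: "linear \<Phi>"
    unfolding linear_iff phase_eq_iff
    by (auto simp: \<Phi>_def linear_add[OF linear_positions] linear_add[OF linear_momenta] linear_add[OF \<pi>(1)]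
        linear_scale[OF linear_positions] linear_scale[OF linear_momenta] linear_scale[OF \<pi>(1)])
  have idem: "\<Phi> (\<Phi> z) = \<Phi> z" for z by (simp add: \<Phi>_def \<pi>(2,3))
  have commM: "\<Phi> (?M *v z) = ?M *v \<Phi> z" for z
  proof -
    have "\<pi> (\<chi> i. indicator D i * momenta z $ i) = 0" by (rule damped0) auto
    moreover have "(\<chi> i. indicator D i * \<pi> (momenta z) $ i) = (0 :: real ^ 'v)"
      using undamped_momenta_vanish[OF \<pi>(2)] by (auto simp: vec_eq_iff indicator_def)
    ultimately show ?thesis
      unfolding drift_matrix_apply \<Phi>_def
      by (simp add: linear_diff[OF \<pi>(1)] linear_neg[OF \<pi>(1)] comm)
  qed
  have kill: "\<Phi> z = 0" if "z \<in> controllable_space ?M D" for z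
  proof -
    have ax: "\<Phi> (axis (Inr i) 1) = 0" if "i \<in> D" for i
    proof -
      have "positions (axis (Inr i) 1) = (0 :: real ^ 'v)" by (simp add: vec_eq_iff axis_def)
      moreover have "\<pi> (momenta (axis (Inr i) 1)) = 0"
        by (rule damped0) (use that in \<open>auto simp: axis_def\<close>)
      ultimately show ?thesis
        by (simp add: \<Phi>_def linear_0[OF \<pi>(1)] phase_eq_iff linear_0[OF linear_positions] linear_0[OF linear_momenta])
    qed
    have "\<Phi> ((((*v) ?M) ^^ k) (axis (Inr i) 1)) = 0" if "i \<in> D" for i k
      by (induction k) (auto simp: ax that commM)
    then have "controllable_space ?M D \<subseteq> {z. \<Phi> z = 0}"
      unfolding controllable_space_def by (intro span_minimal linear_subspace_kernel lin) auto
    then show ?thesis using that by blast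
  qed
  have "\<exists>z. \<Phi> z \<noteq> 0"
  proof -
    obtain p where p: "p \<in> ?P" "p \<noteq> 0"
      using nontrivial subspace_0[OF undamped_momenta_subspace] by blast
    have "momenta (\<Phi> (phase_point 0 p)) \<noteq> 0" using p by (simp add: \<Phi>_def \<pi>(3))
    then have "\<Phi> (phase_point 0 p) \<noteq> 0" using linear_0[OF linear_momenta] by metis
    then show ?thesis by blast
  qed
  then show ?thesis
    by (intro exI[of _ \<Phi>] conjI allI ballI lin idem commM kill)
qed

end

section \<open>Full support implies controllability\<close>

text \<open>Reduces membership to scalar tests, the form in which the Duhamel formula is
  stated.\<close>

lemma in_subspace_if_orthogonal_to_complement:
  fixes S :: "'a::euclidean_space set"
  assumes S: "subspace S" and orth: "\<And>w. (\<And>v. v \<in> S \<Longrightarrow> w \<bullet> v = 0) \<Longrightarrow> w \<bullet> x = 0"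
  shows "x \<in> S"
proof -
  obtain y u where yu: "y \<in> span S" "\<And>v. v \<in> span S \<Longrightarrow> orthogonal u v" "x = y + u"
    using orthogonal_subspace_decomp_exists[of S x] by metis
  have "y \<in> S" using yu(1) S by (simp add: span_eq_iff[THEN iffD2])
  have uv: "u \<bullet> v = 0" if "v \<in> S" for v
    using yu(2)[of v] that by (simp add: orthogonal_def span_base)
  then have "u \<bullet> x = 0" by (rule orth)
  then have "u \<bullet> u = 0" using yu(3) uv[OF \<open>y \<in> S\<close>] by (simp add: inner_add_right)
  then show ?thesis using yu(3) \<open>y \<in> S\<close> by simp
qed

lemma subspace_controllable_space: "subspace (controllable_space M I)"
  by (simp add: controllable_space_def)

lemma open_measure_positive:
  assumes "measure_support \<mu> = UNIV" "open G" "z \<in> G"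
  shows "0 < emeasure \<mu> G"
proof -
  have "z \<in> measure_support \<mu>" using assms(1) by simp
  then show ?thesis using assms(2,3) unfolding measure_support_def by blast
qed

text \<open>Solving the equation for \<open>b\<close> expresses it through the continuous path
  \<open>x\<close> and an indefinite integral, so no separate exceptional set for continuity of the
  noise is needed.\<close>

lemma continuous_on_forcing:
  fixes x b :: "real \<Rightarrow> real ^ 'n::finite"
  assumes x: "continuous_on {0..} x"
    and eq: "\<And>t. 0 \<le> t \<Longrightarrow> ((\<lambda>s. M *v x s) has_integral (x t - z - b t)) {0..t}"
  shows "continuous_on {0..t} b"
proof (cases "0 \<le> t")
  case True
  have xt: "continuous_on {0..t} x" using x by (rule continuous_on_subset) auto
  have "continuous_on {0..t} (\<lambda>s. x s - z - integral {0..s} (\<lambda>s. M *v x s))"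
    using eq[OF True] by (intro continuous_intros xt indefinite_integral_continuous_1) blast
  then show ?thesis
  proof (rule continuous_on_eq)
    fix s assume "s \<in> {0..t}"
    then show "x s - z - integral {0..s} (\<lambda>s. M *v x s) = b s"
      using integral_unique[OF eq[of s]] by auto
  qed
qed auto

section \<open>Affine structure of the solution and consequences for invariant measures\<close>

locale harmonic_network = prob_space W
  for adj :: "'v::finite \<Rightarrow> 'v \<Rightarrow> bool" and damped bdry :: "'v set" and T :: "'v \<Rightarrow> real"
    and W :: "'w measure" and B :: "'v \<Rightarrow> real \<Rightarrow> 'w \<Rightarrow> real" and Z :: "real ^ ('v + 'v) \<Rightarrow> real \<Rightarrow> 'w \<Rightarrow> real ^ ('v + 'v)" +
  assumes sym: "symp adj"
    and solution: "\<And>z. network_solution adj (\<lambda>x. x\<^sup>2 / 2) (\<lambda>x. x\<^sup>2 / 2) damped bdry T W B z (Z z)"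
begin

abbreviation M where "M \<equiv> drift_matrix adj damped"

lemma solution_measurable: "0 \<le> t \<Longrightarrow> Z z t \<in> borel_measurable W"
  using solution[of z] by (simp add: network_solution_def)

lemma solution_path:
  "AE \<omega> in W. continuous_on {0..} (\<lambda>t. Z z t \<omega>) \<and> (\<forall>t\<ge>0.
    ((\<lambda>s. M *v Z z s \<omega>) has_integral (Z z t \<omega> - z - noise_path bdry T B \<omega> t)) {0..t})"
  by (rule harmonic_network_solution[OF sym solution])

text \<open>Both solutions are driven by the same noise, which cancels in their difference; the
  Duhamel formula with zero forcing identifies that difference with the flow.\<close>

lemma solution_eq_flow:
  assumes t: "0 \<le> t"
  shows "AE \<omega> in W. Z z t \<omega> = flow M t z + Z 0 t \<omega>"
  using solution_path[of z] solution_path[of 0]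
proof eventually_elim
  case (elim \<omega>)
  define x where "x s = Z z s \<omega> - Z 0 s \<omega>" for s
  have x: "continuous_on {0..t} x" unfolding x_def
    by (intro continuous_on_diff) (use elim in \<open>auto elim: continuous_on_subset\<close>)
  have "((\<lambda>s. M *v x s) has_integral (x s - z - 0)) {0..s}" if "s \<in> {0..t}" for s
  proof -
    have "((\<lambda>s. M *v Z z s \<omega> - M *v Z 0 s \<omega>) has_integral
        ((Z z s \<omega> - z - noise_path bdry T B \<omega> s) - (Z 0 s \<omega> - 0 - noise_path bdry T B \<omega> s))) {0..s}"
      using elim that by (intro has_integral_diff) auto
    then show ?thesis by (simp add: x_def matrix_vector_mult_diff_distrib algebra_simps)
  qed
  then have "((\<lambda>r. w \<bullet> flow M (t - r) (M *v 0)) has_integral (w \<bullet> (x t - 0 - flow M t z))) {0..t}" for w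
    by (intro linear_equation_duhamel[OF t x, where b = "\<lambda>_. 0"]) auto
  then have "w \<bullet> (x t - flow M t z) = 0" for w
    using has_integral_unique[OF _ has_integral_0] by (fastforce simp: linear_0[OF linear_flow])
  then have "x t - flow M t z = 0" using inner_eq_zero_iff by blast
  then show ?case by (simp add: x_def algebra_simps)
qed

text \<open>The noise path takes values in this space, which is invariant under the drift and hence
  under the flow, so every term of the Duhamel formula stays in it.\<close>

lemma solution_in_controllable_space:
  assumes t: "0 \<le> t"
  shows "AE \<omega> in W. Z 0 t \<omega> \<in> controllable_space M bdry"
  using solution_path[of 0]
proof eventually_elim
  case (elim \<omega>)
  let ?E = "controllable_space M bdry" and ?b = "noise_path bdry T B \<omega>"
  have b: "continuous_on {0..t} ?b"
    using elim by (intro continuous_on_forcing[of "\<lambda>t. Z 0 t \<omega>" M 0]) auto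
  have *: "((\<lambda>s. w \<bullet> flow M (t - s) (M *v ?b s)) has_integral (w \<bullet> (Z 0 t \<omega> - ?b t - flow M t 0))) {0..t}" for w
    by (rule linear_equation_duhamel[OF t _ b]) (use elim in \<open>auto elim: continuous_on_subset\<close>)
  have "Z 0 t \<omega> - ?b t \<in> ?E"
  proof (rule in_subspace_if_orthogonal_to_complement[OF subspace_controllable_space])
    fix w assume w: "\<And>v. v \<in> ?E \<Longrightarrow> w \<bullet> v = 0"
    have "w \<bullet> flow M (t - s) (M *v ?b s) = 0" for s
      by (intro w flow_in_subspace subspace_controllable_space controllable_space_invariant
          noise_path_in_controllable_space)
    then show "w \<bullet> (Z 0 t \<omega> - ?b t) = 0"
      using has_integral_unique[OF *[of w]] by (fastforce simp: linear_0[OF linear_flow])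
  qed
  then have "(Z 0 t \<omega> - ?b t) + ?b t \<in> ?E"
    by (intro subspace_add subspace_controllable_space noise_path_in_controllable_space)
  then show ?case by simp
qed

lemma transition_eq_distr:
  assumes t: "0 \<le> t"
  shows "transition W Z t z = distr W borel (\<lambda>\<omega>. flow M t z + Z 0 t \<omega>)"
  unfolding transition_def
proof (rule distr_cong_AE[OF refl refl])
  show "(\<lambda>\<omega>. flow M t z + Z 0 t \<omega>) \<in> borel_measurable W"
    using solution_measurable[OF t, of 0] by measurable
qed (use solution_eq_flow[OF t] solution_measurable[OF t] in auto)

lemma emeasure_transition:
  assumes t: "0 \<le> t" and A: "A \<in> sets borel"
  shows "emeasure (transition W Z t z) A = emeasure W {\<omega> \<in> space W. flow M t z + Z 0 t \<omega> \<in> A}"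
proof -
  have [measurable]: "Z 0 t \<in> borel_measurable W" by (rule solution_measurable[OF t])
  show ?thesis
    unfolding transition_eq_distr[OF t]
    by (subst emeasure_distr) (auto intro!: arg_cong[of _ _ "emeasure W"] simp: A)
qed

lemma borel_measurable_flow: "flow N t \<in> borel_measurable borel"
  by (intro borel_measurable_continuous_onI continuous_flow_pair continuous_intros)

text \<open>The exceptional set of the equation may vary with the starting point, so joint
  measurability is taken not from \<open>Z\<close> but from the representation as flow plus
  \<open>Z 0 t\<close>, which has the same law.\<close>

lemma transition_measurable:
  assumes t: "0 \<le> t" and A: "A \<in> sets borel"
  shows "(\<lambda>z. emeasure (transition W Z t z) A) \<in> borel_measurable borel"
proof -
  have [measurable]: "Z 0 t \<in> borel_measurable W" by (rule solution_measurable[OF t])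
  note [measurable] = borel_measurable_flow A
  define Q where "Q = {x \<in> space (borel \<Otimes>\<^sub>M W). flow M t (fst x) + Z 0 t (snd x) \<in> A}"
  have Q: "Q \<in> sets (borel \<Otimes>\<^sub>M W)" unfolding Q_def by measurable
  have "emeasure (transition W Z t z) A = emeasure W (Pair z -` Q)" for z
    unfolding emeasure_transition[OF t A]
    by (intro arg_cong[of _ _ "emeasure W"]) (auto simp: Q_def space_pair_measure)
  then show ?thesis using measurable_emeasure_Pair[OF Q] by simp
qed

text \<open>Since the noise contribution lies in the controllable space, \<open>f\<close> leaves it
  alone, and \<open>f\<close> passes through the flow. So \<open>f\<close> maps the solution from
  \<open>z\<close> to the one from \<open>f z\<close>, almost surely at each time, and carries
  invariant measures to invariant measures.\<close>

lemma invariant_prob_distr: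
  assumes inv: "invariant_prob (transition W Z) \<mu>" and f: "linear f"
    and comm: "\<And>z. f (M *v z) = M *v f z"
    and fixes_E: "\<And>z. z \<in> controllable_space M bdry \<Longrightarrow> f z = z"
  shows "invariant_prob (transition W Z) (distr \<mu> borel f)"
proof -
  have sets: "sets \<mu> = sets borel" and ps: "prob_space \<mu>"
    and inv': "\<And>t A. 0 \<le> t \<Longrightarrow> A \<in> sets borel \<Longrightarrow> (\<integral>\<^sup>+ z. emeasure (transition W Z t z) A \<partial>\<mu>) = emeasure \<mu> A"
    using inv by (auto simp: invariant_prob_def)
  have fb[measurable]: "f \<in> borel_measurable borel"
    by (rule borel_measurable_continuous_onI[OF linear_continuous_on[OF linear_conv_bounded_linear[THEN iffD1, OF f]]])
  have fm: "f \<in> measurable \<mu> borel" using fb by (simp cong: measurable_cong_sets[OF sets refl])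
  have eq: "emeasure (transition W Z t (f z)) A = emeasure (transition W Z t z) (f -` A)"
    if t: "0 \<le> t" and A: "A \<in> sets borel" for t A z
  proof -
    have [measurable]: "Z 0 t \<in> borel_measurable W" by (rule solution_measurable[OF t])
    have fA: "f -` A \<in> sets borel" using measurable_sets[OF fb A] by simp
    note [measurable] = A fA
    have "flow M t (f z) + Z 0 t \<omega> = f (flow M t z + Z 0 t \<omega>)" if "Z 0 t \<omega> \<in> controllable_space M bdry" for \<omega>
      using fixes_E[OF that] by (simp add: linear_add[OF f] flow_intertwines[where M' = M, OF f comm])
    then have "AE \<omega> in W. \<omega> \<in> {\<omega> \<in> space W. flow M t (f z) + Z 0 t \<omega> \<in> A}
        \<longleftrightarrow> \<omega> \<in> {\<omega> \<in> space W. flow M t z + Z 0 t \<omega> \<in> f -` A}"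
      using solution_in_controllable_space[OF t] by auto
    then show ?thesis
      unfolding emeasure_transition[OF t A] emeasure_transition[OF t fA]
      by (intro emeasure_eq_AE) measurable
  qed
  show ?thesis
    unfolding invariant_prob_def
  proof (intro conjI allI impI ballI)
    show "prob_space (distr \<mu> borel f)" by (rule prob_space.prob_space_distr[OF ps fm])
    fix t :: real and A :: "(real ^ ('v + 'v)) set" assume t: "0 \<le> t" and A: "A \<in> sets borel"
    have "(\<integral>\<^sup>+ z. emeasure (transition W Z t z) A \<partial>distr \<mu> borel f) = (\<integral>\<^sup>+ z. emeasure (transition W Z t (f z)) A \<partial>\<mu>)"
      by (rule nn_integral_distr[OF fm]) (use transition_measurable[OF t A] in simp)
    also have "\<dots> = (\<integral>\<^sup>+ z. emeasure (transition W Z t z) (f -` A) \<partial>\<mu>)"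
      by (simp add: eq[OF t A])
    also have "\<dots> = emeasure \<mu> (f -` A)"
      by (rule inv'[OF t]) (use measurable_sets[OF fb A] in simp)
    also have "\<dots> = emeasure (distr \<mu> borel f) A"
      using emeasure_distr[OF fm A] sets_eq_imp_space_eq[OF sets] by simp
    finally show "(\<integral>\<^sup>+ z. emeasure (transition W Z t z) A \<partial>distr \<mu> borel f) = emeasure (distr \<mu> borel f) A" .
  qed simp
qed

text \<open>The map \<open>f = id - \<Phi>\<close> takes values in the kernel of the idempotent
  \<open>\<Phi>\<close>. By uniqueness \<open>\<mu>\<close> equals its image under \<open>f\<close>,
  so it would give no mass to the non-empty open set where \<open>\<Phi>\<close> does not
  vanish.\<close>

lemma undamped_momenta_trivial:
  assumes bdry: "bdry \<subseteq> damped"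
    and inv: "invariant_prob (transition W Z) \<mu>"
    and unique: "\<And>\<nu>. invariant_prob (transition W Z) \<nu> \<Longrightarrow> \<nu> = \<mu>"
    and supp: "measure_support \<mu> = UNIV"
  shows "undamped_momenta adj damped = {0}"
proof (rule ccontr)
  assume "undamped_momenta adj damped \<noteq> {0}"
  then obtain \<Phi> where \<Phi>: "linear \<Phi>" "\<And>z. \<Phi> (\<Phi> z) = \<Phi> z" "\<And>z. \<Phi> (M *v z) = M *v \<Phi> z"
    "\<And>z. z \<in> controllable_space M damped \<Longrightarrow> \<Phi> z = 0" "\<exists>z. \<Phi> z \<noteq> 0"
    using undamped_projection[OF sym] by blast
  define f where "f z = z - \<Phi> z" for z
  have f: "linear f" unfolding f_def using linear_compose_sub[OF linear_ident \<Phi>(1)] by simp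
  have sub: "controllable_space M bdry \<subseteq> controllable_space M damped"
    unfolding controllable_space_def by (intro span_mono) (use bdry in blast)
  have "invariant_prob (transition W Z) (distr \<mu> borel f)"
    by (rule invariant_prob_distr[OF inv f]) (use sub \<Phi>(3,4) in \<open>auto simp: f_def matrix_vector_mult_diff_distrib\<close>)
  then have eq: "distr \<mu> borel f = \<mu>" by (rule unique)
  have sets: "sets \<mu> = sets borel" using inv by (simp add: invariant_prob_def)
  define G where "G = {z. \<Phi> z \<noteq> 0}"
  have bl: "bounded_linear \<Phi>" "bounded_linear f" using \<Phi>(1) f by (simp_all add: linear_conv_bounded_linear)
  have G: "open G" unfolding G_def
    by (rule open_Collect_neq) (use linear_continuous_on[OF bl(1)] in \<open>auto intro: continuous_intros\<close>)
  have fm: "f \<in> measurable \<mu> borel"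
    using borel_measurable_continuous_onI[OF linear_continuous_on[OF bl(2)]]
    by (simp cong: measurable_cong_sets[OF sets refl])
  have "f -` G = {}" by (auto simp: f_def G_def linear_diff[OF \<Phi>(1)] \<Phi>(2))
  then have "emeasure (distr \<mu> borel f) G = 0"
    using G by (simp add: emeasure_distr[OF fm])
  moreover obtain z where "z \<in> G" using \<Phi>(5) by (auto simp: G_def)
  ultimately show False using open_measure_positive[OF supp G] eq by auto
qed

text \<open>Tested against \<open>w\<close> the dynamics is deterministic, so the transition
  probability of \<open>A\<close> is an indicator along the flow. The flow tends to 0 and eventually
  leaves \<open>A\<close>; dominated convergence at integer times and invariance give
  \<open>A\<close> mass 0.\<close>

lemma controllable_if_full_support:
  assumes bdry: "bdry \<subseteq> damped"
    and inv: "invariant_prob (transition W Z) \<mu>"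
    and unique: "\<And>\<nu>. invariant_prob (transition W Z) \<nu> \<Longrightarrow> \<nu> = \<mu>"
    and supp: "measure_support \<mu> = UNIV"
  shows "controllable_space M bdry = UNIV"
proof (rule ccontr)
  let ?E = "controllable_space M bdry"
  assume "?E \<noteq> UNIV"
  then obtain x where "x \<notin> ?E" by blast
  then obtain w where w: "\<And>v. v \<in> ?E \<Longrightarrow> w \<bullet> v = 0" "w \<bullet> x \<noteq> 0"
    using in_subspace_if_orthogonal_to_complement[OF subspace_controllable_space] by blast
  interpret \<mu>: prob_space \<mu> using inv by (simp add: invariant_prob_def)
  have sets[measurable_cong]: "sets \<mu> = sets borel" using inv by (simp add: invariant_prob_def)
  \<comment> \<open>The threshold 1 is arbitrary: a single non-empty open null set contradicts full
    support.\<close>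
  define A where "A = {z. 1 < \<bar>w \<bullet> z\<bar>}"
  have A: "open A" unfolding A_def by (intro open_Collect_less continuous_intros)
  have [measurable]: "A \<in> sets borel" using A by simp
  note [measurable] = borel_measurable_flow
  have transition_A: "emeasure (transition W Z t z) A = indicator A (flow M t z)" if t: "0 \<le> t" for t z
  proof -
    have [measurable]: "Z 0 t \<in> borel_measurable W" by (rule solution_measurable[OF t])
    have AE: "AE \<omega> in W. flow M t z + Z 0 t \<omega> \<in> A \<longleftrightarrow> flow M t z \<in> A"
      using solution_in_controllable_space[OF t]
      by eventually_elim (auto simp: A_def inner_add_right w(1))
    have "emeasure W {\<omega> \<in> space W. flow M t z + Z 0 t \<omega> \<in> A} = emeasure W {\<omega> \<in> space W. flow M t z \<in> A}"
      by (rule emeasure_eq_AE) (use AE in auto)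
    then show ?thesis unfolding emeasure_transition[OF t \<open>A \<in> sets borel\<close>]
      by (cases "flow M t z \<in> A") (auto simp: emeasure_space_1)
  qed
  have eq: "(\<integral>\<^sup>+ z. indicator A (flow M (real n) z) \<partial>\<mu>) = emeasure \<mu> A" for n
  proof -
    have "(\<integral>\<^sup>+ z. emeasure (transition W Z (real n) z) A \<partial>\<mu>) = emeasure \<mu> A"
      using inv \<open>A \<in> sets borel\<close> by (auto simp: invariant_prob_def)
    then show ?thesis by (simp add: transition_A)
  qed
  have "(\<lambda>n. \<integral>\<^sup>+ z. indicator A (flow M (real n) z) \<partial>\<mu>) \<longlonglongrightarrow> (\<integral>\<^sup>+ z. 0 \<partial>\<mu>)"
  proof (rule nn_integral_dominated_convergence[where w = "\<lambda>_. 1"])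
    show "AE z in \<mu>. (\<lambda>n. indicator A (flow M (real n) z) :: ennreal) \<longlonglongrightarrow> 0"
    proof (rule AE_I2)
      fix z
      have "(\<lambda>n. \<bar>w \<bullet> flow M (real n) z\<bar>) \<longlonglongrightarrow> \<bar>w \<bullet> 0\<bar>"
        using flow_tendsto_0[OF sym undamped_momenta_trivial[OF bdry inv unique supp], of z]
        by (intro tendsto_intros)
      then have "\<forall>\<^sub>F n in sequentially. \<bar>w \<bullet> flow M (real n) z\<bar> < 1"
        by (rule order_tendstoD) simp
      then have "\<forall>\<^sub>F n in sequentially. (indicator A (flow M (real n) z) :: ennreal) = 0"
        by eventually_elim (auto simp: A_def)
      then show "(\<lambda>n. indicator A (flow M (real n) z) :: ennreal) \<longlonglongrightarrow> 0"
        by (rule tendsto_eventually)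
    qed
  qed (auto simp: \<mu>.emeasure_space_1 indicator_def intro!: AE_I2)
  then have "emeasure \<mu> A = 0" by (simp add: eq LIMSEQ_const_iff)
  \<comment> \<open>Rescaling \<open>x\<close> to have inner product 2 with \<open>w\<close> puts it
    beyond the threshold.\<close>
  moreover have "(2 / (w \<bullet> x)) *\<^sub>R x \<in> A" using w(2) by (simp add: A_def)
  ultimately show False using open_measure_positive[OF supp A] by auto
qed

end

section \<open>Shifts of Gaussian vectors\<close>

definition gaussian_measure :: "real \<Rightarrow> real \<Rightarrow> real measure" where
  "gaussian_measure m \<sigma> = density lborel (\<lambda>x. ennreal (normal_density m \<sigma> x))"

lemma sets_gaussian_measure [simp, measurable_cong]: "sets (gaussian_measure m \<sigma>) = sets borel"
  and space_gaussian_measure [simp]: "space (gaussian_measure m \<sigma>) = UNIV"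
  by (simp_all add: gaussian_measure_def)

lemma prob_space_gaussian_measure: "0 < \<sigma> \<Longrightarrow> prob_space (gaussian_measure m \<sigma>)"
  unfolding gaussian_measure_def by (rule prob_space_normal_density)

lemma distr_gaussian_measure_shift:
  assumes "0 < \<sigma>"
  shows "distr (gaussian_measure 0 \<sigma>) borel (\<lambda>x. x + s) = gaussian_measure s \<sigma>"
proof -
  interpret prob_space "gaussian_measure 0 \<sigma>" by (rule prob_space_gaussian_measure[OF assms])
  have "distributed (gaussian_measure 0 \<sigma>) lborel (\<lambda>x. x) (normal_density 0 \<sigma>)"
    unfolding distributed_def using assms
    by (auto simp: gaussian_measure_def distr_id2)
  from normal_density_affine[OF this assms, of 1 s]
  have "distributed (gaussian_measure 0 \<sigma>) lborel (\<lambda>x. x + s) (normal_density s \<sigma>)"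
    by (simp add: add.commute)
  then show ?thesis
    by (simp add: distributed_def gaussian_measure_def cong: distr_cong)
qed

text \<open>Completing the square.\<close>

lemma density_gaussian_measure:
  assumes "0 < \<sigma>"
  shows "density (gaussian_measure 0 \<sigma>) (\<lambda>x. ennreal (exp (s * x / \<sigma>\<^sup>2 - s\<^sup>2 / (2 * \<sigma>\<^sup>2)))) = gaussian_measure s \<sigma>"
proof -
  have "normal_density 0 \<sigma> x * exp (s * x / \<sigma>\<^sup>2 - s\<^sup>2 / (2 * \<sigma>\<^sup>2)) = normal_density s \<sigma> x" for x
  proof -
    have "- (x\<^sup>2) / (2 * \<sigma>\<^sup>2) + (s * x / \<sigma>\<^sup>2 - s\<^sup>2 / (2 * \<sigma>\<^sup>2)) = - ((x - s)\<^sup>2) / (2 * \<sigma>\<^sup>2)"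
      using assms by (simp add: field_simps power2_eq_square)
    then show ?thesis
      unfolding normal_density_def by (simp add: exp_add[symmetric])
  qed
  then show ?thesis
    unfolding gaussian_measure_def
    by (subst density_density_eq) (auto simp: ennreal_mult[symmetric])
qed

text \<open>The Cameron-Martin formula in finite dimension. Both sides are identified, through their
  values on boxes, with the product of the shifted Gaussians.\<close>

lemma gaussian_vector_shift:
  fixes s :: "'i \<Rightarrow> real"
  assumes \<sigma>: "0 < \<sigma>" and I: "finite I"
  defines "Q \<equiv> PiM I (\<lambda>_. gaussian_measure 0 \<sigma>)"
  shows "distr Q (PiM I (\<lambda>_. borel)) (\<lambda>x. \<lambda>i\<in>I. x i + s i)
    = density Q (\<lambda>x. \<Prod>i\<in>I. ennreal (exp (s i * x i / \<sigma>\<^sup>2 - (s i)\<^sup>2 / (2 * \<sigma>\<^sup>2))))"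
    (is "?L = ?R")
proof -
  note ps = prob_space_gaussian_measure[OF \<sigma>]
  interpret N: product_sigma_finite "\<lambda>_ :: 'i. gaussian_measure 0 \<sigma>"
    by unfold_locales (rule prob_space_imp_sigma_finite[OF ps, THEN sigma_finite_measure.sigma_finite_countable])
  interpret N': product_sigma_finite "\<lambda>i. gaussian_measure (s i) \<sigma>"
    by unfold_locales (rule prob_space_imp_sigma_finite[OF ps, THEN sigma_finite_measure.sigma_finite_countable])
  have setsQ: "sets Q = sets (PiM I (\<lambda>_. borel))" unfolding Q_def by (intro sets_PiM_cong) auto
  have setsN': "sets (PiM I (\<lambda>i. gaussian_measure (s i) \<sigma>)) = sets (PiM I (\<lambda>_. borel))"
    by (intro sets_PiM_cong) auto
  have spQ: "space Q = (\<Pi>\<^sub>E i\<in>I. UNIV)" unfolding Q_def by (simp add: space_PiM)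
  have sm: "(\<lambda>x. \<lambda>i\<in>I. x i + s i) \<in> measurable Q (PiM I (\<lambda>_. borel))"
    unfolding measurable_cong_sets[OF setsQ refl] by measurable
  have "?L = PiM I (\<lambda>i. gaussian_measure (s i) \<sigma>)"
  proof (rule N'.PiM_eqI[OF I])
    fix A assume A: "\<And>i. i \<in> I \<Longrightarrow> A i \<in> sets (gaussian_measure (s i) \<sigma>)"
    define A' where "A' i = (\<lambda>x. x + s i) -` A i" for i
    have A': "A' i \<in> sets borel" if "i \<in> I" for i
      using measurable_sets[of "\<lambda>x. x + s i" borel borel "A i"] A[OF that] by (simp add: A'_def)
    have "emeasure ?L (Pi\<^sub>E I A) = emeasure Q ((\<lambda>x. \<lambda>i\<in>I. x i + s i) -` (Pi\<^sub>E I A) \<inter> space Q)"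
      by (rule emeasure_distr[OF sm]) (use A I in \<open>auto intro!: sets_PiM_I_finite\<close>)
    also have "(\<lambda>x. \<lambda>i\<in>I. x i + s i) -` (Pi\<^sub>E I A) \<inter> space Q = Pi\<^sub>E I A'"
      by (auto simp: spQ A'_def PiE_def extensional_def Pi_def)
    also have "emeasure Q (Pi\<^sub>E I A') = (\<Prod>i\<in>I. emeasure (gaussian_measure 0 \<sigma>) (A' i))"
      unfolding Q_def by (rule N.emeasure_PiM[OF I]) (use A' in auto)
    also have "\<dots> = (\<Prod>i\<in>I. emeasure (gaussian_measure (s i) \<sigma>) (A i))"
    proof (rule prod.cong[OF refl])
      fix i assume "i \<in> I"
      then show "emeasure (gaussian_measure 0 \<sigma>) (A' i) = emeasure (gaussian_measure (s i) \<sigma>) (A i)"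
        using A[of i] unfolding distr_gaussian_measure_shift[OF \<sigma>, of "s i", symmetric]
        by (subst emeasure_distr) (auto simp: A'_def)
    qed
    finally show "emeasure ?L (Pi\<^sub>E I A) = (\<Prod>i\<in>I. emeasure (gaussian_measure (s i) \<sigma>) (A i))" .
  qed (simp add: setsN')
  moreover have "?R = PiM I (\<lambda>i. gaussian_measure (s i) \<sigma>)"
  proof (rule N'.PiM_eqI[OF I])
    let ?w = "\<lambda>i x. ennreal (exp (s i * x / \<sigma>\<^sup>2 - (s i)\<^sup>2 / (2 * \<sigma>\<^sup>2)))"
    fix A assume A: "\<And>i. i \<in> I \<Longrightarrow> A i \<in> sets (gaussian_measure (s i) \<sigma>)"
    have AQ: "Pi\<^sub>E I A \<in> sets Q" unfolding Q_def using A by (intro sets_PiM_I_finite I) auto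
    have wm: "(\<lambda>x. \<Prod>i\<in>I. ?w i (x i)) \<in> borel_measurable Q"
      unfolding Q_def by measurable
    have ind: "indicator (Pi\<^sub>E I A) x = (\<Prod>i\<in>I. indicator (A i) (x i) :: ennreal)" if x: "x \<in> space Q" for x
    proof (cases "x \<in> Pi\<^sub>E I A")
      case True
      then have "(\<Prod>i\<in>I. indicator (A i) (x i) :: ennreal) = 1" by (intro prod.neutral) (auto dest: PiE_mem)
      then show ?thesis using True by simp
    next
      case False
      then obtain i where "i \<in> I" "x i \<notin> A i" using x by (auto simp: spQ PiE_def)
      then have "(\<Prod>i\<in>I. indicator (A i) (x i) :: ennreal) = 0" using I
        by (intro prod_zero bexI[of _ i]) auto
      then show ?thesis using False by simp
    qed
    have "emeasure ?R (Pi\<^sub>E I A) = (\<integral>\<^sup>+ x. (\<Prod>i\<in>I. ?w i (x i)) * indicator (Pi\<^sub>E I A) x \<partial>Q)"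
      by (rule emeasure_density[OF wm AQ])
    also have "\<dots> = (\<integral>\<^sup>+ x. (\<Prod>i\<in>I. ?w i (x i) * indicator (A i) (x i)) \<partial>Q)"
      by (intro nn_integral_cong) (simp add: ind prod.distrib)
    also have "\<dots> = (\<Prod>i\<in>I. \<integral>\<^sup>+ x. ?w i x * indicator (A i) x \<partial>gaussian_measure 0 \<sigma>)"
      unfolding Q_def by (rule N.product_nn_integral_prod[OF I]) (use A in measurable)
    also have "\<dots> = (\<Prod>i\<in>I. emeasure (gaussian_measure (s i) \<sigma>) (A i))"
    proof (rule prod.cong[OF refl])
      fix i assume "i \<in> I"
      then show "(\<integral>\<^sup>+ x. ?w i x * indicator (A i) x \<partial>gaussian_measure 0 \<sigma>) = emeasure (gaussian_measure (s i) \<sigma>) (A i)"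
        using A[of i] unfolding density_gaussian_measure[OF \<sigma>, of "s i", symmetric]
        by (subst emeasure_density) auto
    qed
    finally show "emeasure ?R (Pi\<^sub>E I A) = (\<Prod>i\<in>I. emeasure (gaussian_measure (s i) \<sigma>) (A i))" .
  qed (simp add: setsQ setsN')
  ultimately show ?thesis by simp
qed

text \<open>A quantitative form of absolute continuity that survives weak limits. The number 1 is
  split pointwise into a multiple of the density of the shift by \<open>s\<close> and a multiple of
  that of the opposite shift. The first part reproduces the shifted integral; in the second,
  \<open>g\<close> is bounded by 1 and the density integrates to 1. Of the shift, the error term
  sees only its squared length divided by the variance.\<close>

lemma gaussian_vector_shift_bound:
  fixes s :: "'i \<Rightarrow> real"
  assumes \<sigma>: "0 < \<sigma>" and I: "finite I" and c: "0 < c"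
    and g: "g \<in> borel_measurable (PiM I (\<lambda>_. borel))" "\<And>x. g x \<le> (1 :: ennreal)"
  defines "Q \<equiv> PiM I (\<lambda>_. gaussian_measure 0 \<sigma>)"
  shows "(\<integral>\<^sup>+ x. g x \<partial>Q) \<le> ennreal (c / 2) * (\<integral>\<^sup>+ x. g (\<lambda>i\<in>I. x i + s i) \<partial>Q)
    + ennreal (exp ((\<Sum>i\<in>I. (s i)\<^sup>2) / \<sigma>\<^sup>2) / (2 * c))"
proof -
  define w where "w s x = exp (\<Sum>i\<in>I. s i * x i / \<sigma>\<^sup>2 - (s i)\<^sup>2 / (2 * \<sigma>\<^sup>2))" for s x :: "'i \<Rightarrow> real"
  define q where "q = (\<Sum>i\<in>I. (s i)\<^sup>2) / \<sigma>\<^sup>2"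
  have setsQ: "sets Q = sets (PiM I (\<lambda>_. borel))" unfolding Q_def by (intro sets_PiM_cong) auto
  have w: "(\<Prod>i\<in>I. ennreal (exp (s i * x i / \<sigma>\<^sup>2 - (s i)\<^sup>2 / (2 * \<sigma>\<^sup>2)))) = ennreal (w s x)" for s x :: "'i \<Rightarrow> real"
    by (simp add: prod_ennreal w_def exp_sum I)
  have shift: "(\<integral>\<^sup>+ x. f (\<lambda>i\<in>I. x i + s i) \<partial>Q) = (\<integral>\<^sup>+ x. ennreal (w s x) * f x \<partial>Q)"
    if f: "f \<in> borel_measurable (PiM I (\<lambda>_. borel))" for f :: "('i \<Rightarrow> real) \<Rightarrow> ennreal" and s
  proof -
    have sm: "(\<lambda>x. \<lambda>i\<in>I. x i + s i) \<in> measurable Q (PiM I (\<lambda>_. borel))"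
      unfolding measurable_cong_sets[OF setsQ refl] by measurable
    have wm: "(\<lambda>x. ennreal (w s x)) \<in> borel_measurable Q"
      unfolding measurable_cong_sets[OF setsQ refl] w_def by measurable
    have fQ: "f \<in> borel_measurable Q" using f unfolding measurable_cong_sets[OF setsQ refl] .
    have "(\<integral>\<^sup>+ x. f (\<lambda>i\<in>I. x i + s i) \<partial>Q) = (\<integral>\<^sup>+ x. f x \<partial>distr Q (PiM I (\<lambda>_. borel)) (\<lambda>x. \<lambda>i\<in>I. x i + s i))"
      by (rule nn_integral_distr[OF sm, symmetric]) (use f in simp)
    also have "\<dots> = (\<integral>\<^sup>+ x. f x \<partial>density Q (\<lambda>x. ennreal (w s x)))"
      unfolding Q_def gaussian_vector_shift[OF \<sigma> I] w ..
    also have "\<dots> = (\<integral>\<^sup>+ x. ennreal (w s x) * f x \<partial>Q)"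
      by (rule nn_integral_density[OF wm fQ])
    finally show ?thesis .
  qed
  have "prob_space Q" unfolding Q_def by (intro prob_space_PiM prob_space_gaussian_measure \<sigma>)
  then have "(\<integral>\<^sup>+ x. 1 \<partial>Q) = 1" by (simp add: prob_space.emeasure_space_1)
  \<comment> \<open>Shifting the constant function 1 shows that the density of the opposite shift
    has total mass 1.\<close>
  then have w1: "(\<integral>\<^sup>+ x. ennreal (w (\<lambda>i. - s i) x) \<partial>Q) = 1"
    using shift[of "\<lambda>_. 1" "\<lambda>i. - s i"] by simp
  have ww: "w s x * w (\<lambda>i. - s i) x = exp (- q)" for x
  proof -
    have "(\<Sum>i\<in>I. s i * x i / \<sigma>\<^sup>2 - (s i)\<^sup>2 / (2 * \<sigma>\<^sup>2)) + (\<Sum>i\<in>I. - s i * x i / \<sigma>\<^sup>2 - (- s i)\<^sup>2 / (2 * \<sigma>\<^sup>2)) = - q"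
      unfolding q_def sum.distrib[symmetric] sum_divide_distrib sum_negf[symmetric]
      by (intro sum.cong refl) (simp add: field_simps)
    then show ?thesis unfolding w_def exp_add[symmetric] by simp
  qed
  \<comment> \<open>\<open>1 \<le> (a + b) / 2\<close> whenever \<open>a b = 1\<close>, applied to \<open>a = c w\<^sub>s\<close> and \<open>b = e\<^sup>q w\<^bsub>-s\<^esub> / c\<close>.\<close>
  have pw: "g x \<le> ennreal (c / 2) * (ennreal (w s x) * g x) + ennreal (exp q / (2 * c)) * ennreal (w (\<lambda>i. - s i) x)" for x
  proof -
    define a b where "a = c * w s x" and "b = exp q / c * w (\<lambda>i. - s i) x"
    have pos: "0 < w s x" "0 < w (\<lambda>i. - s i) x" by (auto simp: w_def)
    have "a * b = 1"
      using ww[of x] c unfolding a_def b_def by (simp add: field_simps exp_minus)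
    moreover have "0 \<le> (a - b)\<^sup>2" by simp
    moreover have "0 < a" "0 < b" using pos c by (auto simp: a_def b_def)
    ultimately have "2\<^sup>2 \<le> (a + b)\<^sup>2" by (simp add: power2_sum power2_diff)
    then have "2 \<le> a + b"
      by (rule power2_le_imp_le) (use \<open>0 < a\<close> \<open>0 < b\<close> in simp)
    then have ab: "1 \<le> (a + b) / 2" by simp
    have "g x = g x * 1" by simp
    also have "\<dots> \<le> g x * ennreal ((a + b) / 2)"
      using ab by (intro mult_left_mono) (auto simp: ennreal_ge_1)
    also have "\<dots> = ennreal (a / 2) * g x + ennreal (b / 2) * g x"
      using \<open>0 < a\<close> \<open>0 < b\<close> by (simp add: add_divide_distrib distrib_left mult.commute)
    also have "\<dots> \<le> ennreal (a / 2) * g x + ennreal (b / 2) * 1"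
      by (intro add_mono mult_left_mono g(2) order_refl) auto
    also have "ennreal (a / 2) * g x = ennreal (c / 2) * (ennreal (w s x) * g x)"
      using c pos by (simp add: a_def mult.assoc[symmetric] flip: ennreal_mult)
    also have "ennreal (b / 2) * 1 = ennreal (exp q / (2 * c)) * ennreal (w (\<lambda>i. - s i) x)"
      using c pos by (simp add: b_def flip: ennreal_mult)
    finally show ?thesis .
  qed
  have m[measurable]: "(\<lambda>x. ennreal (w s x) * g x) \<in> borel_measurable Q" "(\<lambda>x. ennreal (w (\<lambda>i. - s i) x)) \<in> borel_measurable Q"
    using g(1) unfolding measurable_cong_sets[OF setsQ refl] w_def by measurable
  have "(\<integral>\<^sup>+ x. g x \<partial>Q) \<le> (\<integral>\<^sup>+ x. ennreal (c / 2) * (ennreal (w s x) * g x) + ennreal (exp q / (2 * c)) * ennreal (w (\<lambda>i. - s i) x) \<partial>Q)"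
    by (intro nn_integral_mono pw)
  also have "\<dots> = ennreal (c / 2) * (\<integral>\<^sup>+ x. ennreal (w s x) * g x \<partial>Q)
      + ennreal (exp q / (2 * c)) * (\<integral>\<^sup>+ x. ennreal (w (\<lambda>i. - s i) x) \<partial>Q)"
    by (simp add: nn_integral_add nn_integral_cmult)
  finally show ?thesis by (simp add: shift[OF g(1)] w1 q_def)
qed

text \<open>By independence and Fubini, \<open>Y\<close> can be frozen while the Gaussian vector
  \<open>X\<close> is shifted; the bound for each frozen value has the same constants.\<close>

lemma (in prob_space) indep_gaussian_shift_bound:
  fixes s :: "'i \<Rightarrow> real" and Y :: "'a \<Rightarrow> 'y" and X :: "'a \<Rightarrow> 'i \<Rightarrow> real"
  assumes \<sigma>: "0 < \<sigma>" and I: "finite I" and c: "0 < c"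
    and Y: "Y \<in> measurable M S" and Xm: "X \<in> measurable M (PiM I (\<lambda>_. borel))"
    and indep: "distr M (S \<Otimes>\<^sub>M PiM I (\<lambda>_. borel)) (\<lambda>\<omega>. (Y \<omega>, X \<omega>))
      = distr M S Y \<Otimes>\<^sub>M distr M (PiM I (\<lambda>_. borel)) X"
    and X: "distr M (PiM I (\<lambda>_. borel)) X = PiM I (\<lambda>_. gaussian_measure 0 \<sigma>)"
    and F: "case_prod F \<in> borel_measurable (S \<Otimes>\<^sub>M PiM I (\<lambda>_. borel))" "\<And>y x. F y x \<le> (1 :: ennreal)"
  shows "(\<integral>\<^sup>+ \<omega>. F (Y \<omega>) (X \<omega>) \<partial>M) \<le> ennreal (c / 2) * (\<integral>\<^sup>+ \<omega>. F (Y \<omega>) (\<lambda>i\<in>I. X \<omega> i + s i) \<partial>M)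
    + ennreal (exp ((\<Sum>i\<in>I. (s i)\<^sup>2) / \<sigma>\<^sup>2) / (2 * c))"
proof -
  define P where "P = PiM I (\<lambda>_ :: 'i. borel :: real measure)"
  define Q where "Q = PiM I (\<lambda>_ :: 'i. gaussian_measure 0 \<sigma>)"
  note [measurable] = F(1)[folded P_def]
  have setsQ[measurable_cong]: "sets Q = sets P" unfolding Q_def P_def by (intro sets_PiM_cong) auto
  have m[measurable]: "Y \<in> measurable M S" "X \<in> measurable M P"
    using Y Xm by (auto simp: P_def)
  interpret Y: prob_space "distr M S Y" by (rule prob_space_distr) simp
  interpret Q: prob_space Q unfolding Q_def by (intro prob_space_PiM prob_space_gaussian_measure \<sigma>)
  have eq: "distr M (S \<Otimes>\<^sub>M P) (\<lambda>\<omega>. (Y \<omega>, X \<omega>)) = distr M S Y \<Otimes>\<^sub>M Q"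
    using indep X by (simp add: P_def Q_def)
  have fub: "(\<integral>\<^sup>+ \<omega>. G (Y \<omega>) (X \<omega>) \<partial>M) = (\<integral>\<^sup>+ y. \<integral>\<^sup>+ x. G y x \<partial>Q \<partial>distr M S Y)"
    if G: "case_prod G \<in> borel_measurable (S \<Otimes>\<^sub>M P)" for G :: "'y \<Rightarrow> ('i \<Rightarrow> real) \<Rightarrow> ennreal"
  proof -
    have "(\<integral>\<^sup>+ \<omega>. G (Y \<omega>) (X \<omega>) \<partial>M) = (\<integral>\<^sup>+ p. case_prod G p \<partial>distr M (S \<Otimes>\<^sub>M P) (\<lambda>\<omega>. (Y \<omega>, X \<omega>)))"
      by (subst nn_integral_distr) (use G in auto)
    also have "\<dots> = (\<integral>\<^sup>+ y. \<integral>\<^sup>+ x. case_prod G (y, x) \<partial>Q \<partial>distr M S Y)"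
      unfolding eq by (rule Q.nn_integral_fst[symmetric]) (use G in measurable)
    finally show ?thesis by simp
  qed
  have shift[measurable]: "(\<lambda>x. \<lambda>i\<in>I. x i + s i) \<in> measurable P P"
    unfolding P_def by measurable
  have F2: "case_prod (\<lambda>y x. F y (\<lambda>i\<in>I. x i + s i)) \<in> borel_measurable (S \<Otimes>\<^sub>M P)"
    by measurable
  have "(\<integral>\<^sup>+ \<omega>. F (Y \<omega>) (X \<omega>) \<partial>M) = (\<integral>\<^sup>+ y. \<integral>\<^sup>+ x. F y x \<partial>Q \<partial>distr M S Y)"
    by (rule fub) measurable
  also have "\<dots> \<le> (\<integral>\<^sup>+ y. ennreal (c / 2) * (\<integral>\<^sup>+ x. F y (\<lambda>i\<in>I. x i + s i) \<partial>Q)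
      + ennreal (exp ((\<Sum>i\<in>I. (s i)\<^sup>2) / \<sigma>\<^sup>2) / (2 * c)) \<partial>distr M S Y)"
  proof (rule nn_integral_mono)
    fix y assume "y \<in> space (distr M S Y)"
    then have "F y \<in> borel_measurable P" by simp
    then show "(\<integral>\<^sup>+ x. F y x \<partial>Q) \<le> ennreal (c / 2) * (\<integral>\<^sup>+ x. F y (\<lambda>i\<in>I. x i + s i) \<partial>Q)
      + ennreal (exp ((\<Sum>i\<in>I. (s i)\<^sup>2) / \<sigma>\<^sup>2) / (2 * c))"
      unfolding Q_def P_def by (intro gaussian_vector_shift_bound \<sigma> I c F(2))
  qed
  also have "\<dots> = ennreal (c / 2) * (\<integral>\<^sup>+ y. \<integral>\<^sup>+ x. F y (\<lambda>i\<in>I. x i + s i) \<partial>Q \<partial>distr M S Y)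
      + ennreal (exp ((\<Sum>i\<in>I. (s i)\<^sup>2) / \<sigma>\<^sup>2) / (2 * c))"
  proof -
    have 1: "emeasure (distr M S Y) (space S) = 1" using Y.emeasure_space_1 by simp
    have "(\<lambda>y. \<integral>\<^sup>+ x. F y (\<lambda>i\<in>I. x i + s i) \<partial>Q) \<in> borel_measurable (distr M S Y)"
      by (rule Q.borel_measurable_nn_integral) (use F2 in measurable)
    then show ?thesis by (simp add: nn_integral_add nn_integral_cmult 1)
  qed
  also have "(\<integral>\<^sup>+ y. \<integral>\<^sup>+ x. F y (\<lambda>i\<in>I. x i + s i) \<partial>Q \<partial>distr M S Y) = (\<integral>\<^sup>+ \<omega>. F (Y \<omega>) (\<lambda>i\<in>I. X \<omega> i + s i) \<partial>M)"
    by (rule fub[OF F2, symmetric])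
  finally show ?thesis .
qed

section \<open>Convergence of left-endpoint Riemann sums\<close>

lemma riemann_sum_tendsto:
  fixes f :: "real \<Rightarrow> real"
  assumes f: "continuous_on {0..1} f"
  shows "(\<lambda>n. (\<Sum>k<Suc n. f (real k / real (Suc n))) / real (Suc n)) \<longlonglongrightarrow> integral {0..1} f"
proof (rule LIMSEQ_I)
  fix e :: real assume e: "0 < e"
  define F where "F u = integral {0..u} f" for u
  have F: "(F has_derivative (\<lambda>h. f u * h)) (at u within {0..1})" if "u \<in> {0..1}" for u
    using integral_has_real_derivative[OF f that] by (simp add: F_def[abs_def] has_field_derivative_def)
  have "uniformly_continuous_on {0..1} f" by (intro compact_uniformly_continuous f) simp
  then obtain d where d: "0 < d" "\<And>x y. x \<in> {0..1} \<Longrightarrow> y \<in> {0..1} \<Longrightarrow> dist y x < d \<Longrightarrow> dist (f y) (f x) < e / 2"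
    unfolding uniformly_continuous_on_def using half_gt_zero[OF e] by metis
  obtain n0 where n0: "1 / d < real n0" using reals_Archimedean2 by blast
  show "\<exists>no. \<forall>n\<ge>no. norm ((\<Sum>k<Suc n. f (real k / real (Suc n))) / real (Suc n) - integral {0..1} f) < e"
  proof (intro exI allI impI)
    fix n assume n: "n0 \<le> n"
    define m where "m = real (Suc n)"
    have m: "0 < m" "1 / m < d"
    proof -
      show "0 < m" by (simp add: m_def)
      have "1 / d < m" using n0 n by (simp add: m_def)
      then show "1 / m < d" using d(1) \<open>0 < m\<close> by (simp add: field_simps)
    qed
    \<comment> \<open>The mean value theorem for the primitive gives the integral over a cell as a
      value of \<open>f\<close> in that cell times the width. Each of the m cells contributes at
      most e/(2m), so the total stays at e/2.\<close>
    have step: "\<bar>f (real k / m) / m - (F (real (Suc k) / m) - F (real k / m))\<bar> \<le> e / 2 / m" if k: "k < Suc n" for k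
    proof -
      have ab: "real k / m < real (Suc k) / m" "0 \<le> real k / m" "real (Suc k) / m \<le> 1"
        using m k by (auto simp: field_simps m_def)
      have "\<exists>x\<in>{real k / m<..<real (Suc k) / m}. F (real (Suc k) / m) - F (real k / m) = f x * (real (Suc k) / m - real k / m)"
        by (rule mvt_simple[OF ab(1)]) (use ab in \<open>auto intro!: has_derivative_subset[OF F]\<close>)
      then obtain x where x: "real k / m < x" "x < real (Suc k) / m"
          "F (real (Suc k) / m) - F (real k / m) = f x * (real (Suc k) / m - real k / m)" by auto
      have w: "real (Suc k) / m - real k / m = 1 / m" by (simp add: diff_divide_distrib[symmetric])
      have "\<bar>f (real k / m) - f x\<bar> \<le> e / 2"
        using d(2)[of x "real k / m"] x(1,2) ab w m by (auto simp: dist_real_def)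
      moreover have "f (real k / m) / m - (F (real (Suc k) / m) - F (real k / m)) = (f (real k / m) - f x) / m"
        unfolding x(3) w by (simp add: diff_divide_distrib)
      moreover have "\<bar>f (real k / m) - f x\<bar> / m \<le> e / 2 / m"
        by (intro divide_right_mono calculation(1)) (use m in simp)
      ultimately show ?thesis using m by (simp only: abs_divide abs_of_pos)
    qed
    have "integral {0..1} f = (\<Sum>k<Suc n. F (real (Suc k) / m) - F (real k / m))"
      by (subst sum_lessThan_telescope) (simp add: F_def m_def)
    then have "(\<Sum>k<Suc n. f (real k / m)) / m - integral {0..1} f
        = (\<Sum>k<Suc n. f (real k / m) / m - (F (real (Suc k) / m) - F (real k / m)))"
      by (simp only: sum_divide_distrib sum_subtractf)
    also have "\<bar>\<dots>\<bar> \<le> (\<Sum>k<Suc n. e / 2 / m)"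
      by (rule order_trans[OF sum_abs sum_mono]) (use step in auto)
    also have "\<dots> = m * (e / 2 / m)" by (simp add: m_def)
    also have "\<dots> = e / 2" using m(1) by simp
    finally show "norm ((\<Sum>k<Suc n. f (real k / real (Suc n))) / real (Suc n) - integral {0..1} f) < e"
      using e by (simp add: m_def)
  qed
qed

lemma riemann_sum_tendsto_vec:
  fixes f :: "real \<Rightarrow> real ^ 'n::finite"
  assumes f: "continuous_on {0..1} f"
  shows "(\<lambda>n. (1 / real (Suc n)) *\<^sub>R (\<Sum>k<Suc n. f (real k / real (Suc n)))) \<longlonglongrightarrow> integral {0..1} f"
proof (rule vec_tendstoI)
  fix i
  have "(f has_integral integral {0..1} f) {0..1}"
    by (intro integrable_integral integrable_continuous_interval f)
  then have "((\<lambda>s. f s $ i) has_integral integral {0..1} f $ i) {0..1}"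
    using has_integral_linear[OF _ bounded_linear_vec_nth[of i]] by (auto simp: o_def)
  moreover have "continuous_on {0..1} (\<lambda>s. f s $ i)" using f by (intro continuous_intros)
  ultimately show "(\<lambda>n. ((1 / real (Suc n)) *\<^sub>R (\<Sum>k<Suc n. f (real k / real (Suc n)))) $ i) \<longlonglongrightarrow> integral {0..1} f $ i"
    using riemann_sum_tendsto[of "\<lambda>s. f s $ i"] by (simp add: integral_unique)
qed

section \<open>Reachable states\<close>

text \<open>Discretised Duhamel formula at time one for the start at 0. It is linear in
  \<open>b\<close> and reads \<open>b\<close> only at the grid times k/(n+1), including the endpoint
  1, so it is a function of finitely many increments of a path that vanishes at 0.\<close>

definition duhamel_sum :: "real ^ 'n ^ 'n \<Rightarrow> nat \<Rightarrow> (real \<Rightarrow> real ^ 'n::finite) \<Rightarrow> real ^ 'n" where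
  "duhamel_sum A n b = b 1 + (1 / real (Suc n)) *\<^sub>R
     (\<Sum>k<Suc n. flow A (1 - real k / real (Suc n)) (A *v b (real k / real (Suc n))))"

lemma duhamel_sum_cong:
  assumes "\<And>k. k \<le> Suc n \<Longrightarrow> b (real k / real (Suc n)) = b' (real k / real (Suc n))"
  shows "duhamel_sum A n b = duhamel_sum A n b'"
  using assms assms[of "Suc n"] by (simp add: duhamel_sum_def)

lemma duhamel_sum_add: "duhamel_sum A n (\<lambda>t. b t + b' t) = duhamel_sum A n b + duhamel_sum A n b'"
  by (simp add: duhamel_sum_def matrix_vector_right_distrib linear_add[OF linear_flow] sum.distrib scaleR_add_right)

lemma duhamel_sum_scaleR: "duhamel_sum A n (\<lambda>t. c *\<^sub>R b t) = c *\<^sub>R duhamel_sum A n b"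
  by (simp add: duhamel_sum_def matrix_vector_mult_scaleR linear_scale[OF linear_flow] scaleR_sum_right
      scaleR_add_right mult.commute)

lemma duhamel_sum_sum:
  "duhamel_sum A n (\<lambda>t. \<Sum>i\<in>J. b i t) = (\<Sum>i\<in>J. duhamel_sum A n (b i))"
proof (induction J rule: infinite_finite_induct)
  case (insert i J)
  then show ?case by (simp add: duhamel_sum_add)
qed (simp_all add: duhamel_sum_def linear_0[OF linear_flow])

lemma borel_measurable_duhamel_sum:
  assumes b: "\<And>k. k \<le> Suc n \<Longrightarrow> (\<lambda>x. b x (real k / real (Suc n))) \<in> borel_measurable N"
  shows "(\<lambda>x. duhamel_sum A n (b x)) \<in> borel_measurable N"
proof -
  have "(\<lambda>u. flow A t (A *v u)) \<in> borel_measurable borel" for t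
    by (rule borel_measurable_continuous_onI[OF continuous_flow_pair[OF continuous_on_const linear_continuous_on]]) simp
  then have "(\<lambda>x. flow A t (A *v b x (real k / real (Suc n)))) \<in> borel_measurable N" if "k \<le> Suc n" for t k
    using measurable_compose[OF b[OF that]] by blast
  moreover have "(\<lambda>x. b x 1) \<in> borel_measurable N" using b[of "Suc n"] by simp
  ultimately show ?thesis
    unfolding duhamel_sum_def by (intro borel_measurable_add borel_measurable_scaleR borel_measurable_sum) auto
qed

lemma continuous_duhamel_integrand:
  assumes "continuous_on {0..1} b"
  shows "continuous_on {0..1} (\<lambda>s. flow A (1 - s) (A *v b s))"
  by (intro continuous_flow_pair continuous_intros linear_continuous_on_compose[OF assms]) auto

lemma duhamel_sum_tendsto:
  assumes b: "continuous_on {0..1} b"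
  shows "(\<lambda>n. duhamel_sum A n b) \<longlonglongrightarrow> b 1 + integral {0..1} (\<lambda>s. flow A (1 - s) (A *v b s))"
  unfolding duhamel_sum_def
  by (intro tendsto_intros riemann_sum_tendsto_vec[OF continuous_duhamel_integrand[OF b]])

lemma duhamel_integral_inner:
  assumes b: "continuous_on {0..1} b"
  shows "((\<lambda>s. w \<bullet> flow A (1 - s) (A *v b s)) has_integral
    w \<bullet> integral {0..1} (\<lambda>s. flow A (1 - s) (A *v b s))) {0..1}"
  using has_integral_linear[OF integrable_integral[OF integrable_continuous_interval[OF
      continuous_duhamel_integrand[OF b]]] bounded_linear_inner_right[of w]]
  by (simp add: o_def)

text \<open>The Riemann sums converge to the Duhamel integral, which the tested formula identifies
  with \<open>x 1 - b 1\<close>. This is what applies the discretisation to almost every noise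
  path.\<close>

lemma duhamel_sum_tendsto_solution:
  assumes x: "continuous_on {0..} x"
    and eq: "\<And>t. 0 \<le> t \<Longrightarrow> ((\<lambda>s. A *v x s) has_integral (x t - b t)) {0..t}"
  shows "(\<lambda>n. duhamel_sum A n b) \<longlonglongrightarrow> x 1"
proof -
  have b: "continuous_on {0..1} b"
    by (rule continuous_on_forcing[OF x, of A 0]) (use eq in auto)
  have "((\<lambda>s. w \<bullet> flow A (1 - s) (A *v b s)) has_integral w \<bullet> (x 1 - b 1 - flow A 1 0)) {0..1}" for w
    by (rule linear_equation_duhamel[OF _ continuous_on_subset[OF x] b]) (use eq in auto)
  then have "w \<bullet> (x 1 - b 1) = w \<bullet> integral {0..1} (\<lambda>s. flow A (1 - s) (A *v b s))" for w
    using has_integral_unique[OF _ duhamel_integral_inner[OF b]] by (fastforce simp: linear_0[OF linear_flow])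
  then have "x 1 - b 1 = integral {0..1} (\<lambda>s. flow A (1 - s) (A *v b s))"
    using vector_eq_ldot by blast
  then show ?thesis using duhamel_sum_tendsto[OF b, of A] by (simp add: algebra_simps)
qed

text \<open>The time-one states \<open>x(1)\<close> of \<open>dx = A x dt + e d\<phi>\<close>, \<open>x(0) = 0\<close>, for Lipschitz controls \<open>\<phi>\<close>.\<close>

definition reachable :: "real ^ 'n ^ 'n \<Rightarrow> real ^ 'n::finite \<Rightarrow> real ^ 'n \<Rightarrow> bool" where
  "reachable A e v \<longleftrightarrow> (\<exists>\<phi> K. \<phi> 0 = 0 \<and> (\<forall>s t. 0 \<le> s \<longrightarrow> s \<le> t \<longrightarrow> t \<le> 1 \<longrightarrow> \<bar>\<phi> t - \<phi> s\<bar> \<le> K * (t - s)) \<and>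
     (\<lambda>n. duhamel_sum A n (\<lambda>t. \<phi> t *\<^sub>R e)) \<longlonglongrightarrow> v)"

lemma reachable_scaleR:
  assumes "reachable A e v"
  shows "reachable A e (c *\<^sub>R v)"
proof -
  obtain \<phi> K where \<phi>: "\<phi> 0 = 0" "\<And>s t. 0 \<le> s \<Longrightarrow> s \<le> t \<Longrightarrow> t \<le> 1 \<Longrightarrow> \<bar>\<phi> t - \<phi> s\<bar> \<le> K * (t - s)"
     "(\<lambda>n. duhamel_sum A n (\<lambda>t. \<phi> t *\<^sub>R e)) \<longlonglongrightarrow> v"
    using assms unfolding reachable_def by blast
  have "\<bar>c * \<phi> t - c * \<phi> s\<bar> \<le> (\<bar>c\<bar> * K) * (t - s)" if "0 \<le> s" "s \<le> t" "t \<le> 1" for s t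
    using mult_left_mono[OF \<phi>(2)[OF that], of "\<bar>c\<bar>"]
    by (simp add: abs_mult[symmetric] right_diff_distrib mult.assoc)
  moreover have "(\<lambda>n. duhamel_sum A n (\<lambda>t. (c * \<phi> t) *\<^sub>R e)) \<longlonglongrightarrow> c *\<^sub>R v"
    using tendsto_scaleR[OF tendsto_const \<phi>(3), of c] by (simp add: duhamel_sum_scaleR[symmetric])
  ultimately show ?thesis
    unfolding reachable_def using \<phi>(1)
    by (intro exI[of _ "\<lambda>t. c * \<phi> t"] exI[of _ "\<bar>c\<bar> * K"]) auto
qed

text \<open>For the control with \<open>\<phi>'(s) = w \<bullet> exp((1-s)A) e\<close>, integration by parts gives
  \<open>w \<bullet> x(1) = \<integral>\<^sub>0\<^sup>1 \<phi>'(s)\<^sup>2 ds\<close>.\<close>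

lemma orthogonal_to_reachable:
  assumes w: "\<And>v. reachable A e v \<Longrightarrow> w \<bullet> v = 0"
  shows "w \<bullet> (((*v) A) ^^ k) e = 0"
proof -
  define \<psi> where "\<psi> s = w \<bullet> flow A (1 - s) e" for s
  define \<phi> where "\<phi> t = integral {0..t} \<psi>" for t
  have \<psi>_deriv: "(\<psi> has_real_derivative - (w \<bullet> flow A (1 - s) (A *v e))) (at s within S)" for s S
  proof -
    have "((\<lambda>s. 1 - s :: real) has_real_derivative -1) (at s within S)"
      by (auto intro!: derivative_eq_intros)
    from DERIV_chain2[OF flow_inner_DERIV this, of w A e] show ?thesis
      by (simp add: \<psi>_def[abs_def])
  qed
  have \<psi>c: "continuous_on S \<psi>" for S
    by (rule DERIV_continuous_on) (rule \<psi>_deriv)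
  have \<phi>_deriv: "(\<phi> has_real_derivative \<psi> s) (at s within {0..1})" if "s \<in> {0..1}" for s
    using integral_has_real_derivative[OF \<psi>c that] by (simp add: \<phi>_def[abs_def])
  have \<phi>c: "continuous_on {0..1} \<phi>" by (rule DERIV_continuous_on) (rule \<phi>_deriv)
  have \<phi>0: "\<phi> 0 = 0" by (simp add: \<phi>_def)
  have "bounded (\<psi> ` {0..1})" by (intro compact_imp_bounded compact_continuous_image \<psi>c) simp
  then obtain K where K: "\<forall>s\<in>{0..1}. \<bar>\<psi> s\<bar> \<le> K" by (auto simp: bounded_iff)
  have lip: "\<bar>\<phi> t - \<phi> s\<bar> \<le> K * (t - s)" if st: "0 \<le> s" "s \<le> t" "t \<le> 1" for s t
  proof -
    have "norm (\<phi> t - \<phi> s) \<le> K * norm (t - s)"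
      by (rule field_differentiable_bound[of "{0..1}" \<phi> \<psi>]) (use st \<phi>_deriv K in auto)
    then show ?thesis using st by simp
  qed
  define I where "I = integral {0..1} (\<lambda>s. flow A (1 - s) (A *v (\<phi> s *\<^sub>R e)))"
  have pc: "continuous_on {0..1} (\<lambda>t. \<phi> t *\<^sub>R e)" by (intro continuous_intros \<phi>c)
  have "reachable A e (\<phi> 1 *\<^sub>R e + I)"
    unfolding reachable_def I_def using \<phi>0 lip duhamel_sum_tendsto[OF pc, of A] by blast
  then have w0: "w \<bullet> (\<phi> 1 *\<^sub>R e + I) = 0" by (rule w)
  have wI: "((\<lambda>s. \<phi> s * (w \<bullet> flow A (1 - s) (A *v e))) has_integral w \<bullet> I) {0..1}"
    using duhamel_integral_inner[OF pc, of w A]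
    by (simp add: I_def matrix_vector_mult_scaleR linear_scale[OF linear_flow])
  have "((\<lambda>s. \<phi> s * \<psi> s) has_real_derivative
      (\<psi> s)\<^sup>2 - \<phi> s * (w \<bullet> flow A (1 - s) (A *v e))) (at s within {0..1})" if "s \<in> {0..1}" for s
    using DERIV_mult[OF \<phi>_deriv[OF that] \<psi>_deriv] by (simp add: power2_eq_square algebra_simps)
  then have "((\<lambda>s. (\<psi> s)\<^sup>2 - \<phi> s * (w \<bullet> flow A (1 - s) (A *v e))) has_integral (\<phi> 1 * \<psi> 1 - \<phi> 0 * \<psi> 0)) {0..1}"
    by (intro fundamental_theorem_of_calculus) (auto simp: has_real_derivative_iff_has_vector_derivative)
  from has_integral_add[OF this wI]
  have "((\<lambda>s. (\<psi> s)\<^sup>2) has_integral w \<bullet> (\<phi> 1 *\<^sub>R e + I)) {0..1}"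
    by (simp add: \<phi>0 \<psi>_def inner_add_right)
  then have "integral {0..1} (\<lambda>s. (\<psi> s)\<^sup>2) = 0" using w0 by (simp add: integral_unique)
  moreover have "integral {0..1} (\<lambda>s. (\<psi> s)\<^sup>2) = 0 \<longleftrightarrow> (\<forall>s\<in>{0..1}. (\<psi> s)\<^sup>2 = 0)"
    by (rule integral_eq_0_iff) (auto intro!: continuous_intros \<psi>c)
  ultimately have "\<psi> s = 0" if "s \<in> {0..1}" for s using that by auto
  then have "w \<bullet> flow A t e = 0" if "0 < t" "t < 1" for t
    using that \<psi>_def[of "1 - t"] by auto
  then show ?thesis by (rule flow_inner_eq_0_imp_iterates)
qed

text \<open>By duality: a vector orthogonal to everything reachable is orthogonal to all iterates of
  the controlled directions, hence to the controllable space.\<close>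

lemma span_reachable:
  assumes "controllable_space A I = UNIV"
  shows "span {v. \<exists>i\<in>I. reachable A (axis (Inr i) 1) v} = UNIV"
proof -
  have "x \<in> span {v. \<exists>i\<in>I. reachable A (axis (Inr i) 1) v}" for x
  proof (rule in_subspace_if_orthogonal_to_complement[OF subspace_span])
    fix w assume w: "\<And>v. v \<in> span {v. \<exists>i\<in>I. reachable A (axis (Inr i) 1) v} \<Longrightarrow> w \<bullet> v = 0"
    have "w \<bullet> (((*v) A) ^^ k) (axis (Inr i) 1) = 0" if "i \<in> I" for i k
      by (rule orthogonal_to_reachable) (use that in \<open>auto intro!: w span_base\<close>)
    then have "controllable_space A I \<subseteq> {u. w \<bullet> u = 0}"
      unfolding controllable_space_def by (intro span_minimal subspace_hyperplane) auto
    then show "w \<bullet> x = 0" using assms by auto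
  qed
  then show ?thesis by blast
qed

section \<open>Product laws, Brownian increments and bump functions\<close>

lemma distr_pair_product_map:
  assumes "prob_space M"
    and U[measurable]: "U \<in> measurable M A" and V[measurable]: "V \<in> measurable M C"
    and f[measurable]: "f \<in> measurable A S" and h[measurable]: "h \<in> measurable C P"
    and eq: "distr M (A \<Otimes>\<^sub>M C) (\<lambda>\<omega>. (U \<omega>, V \<omega>)) = distr M A U \<Otimes>\<^sub>M distr M C V"
  shows "distr M (S \<Otimes>\<^sub>M P) (\<lambda>\<omega>. (f (U \<omega>), h (V \<omega>))) = distr M S (\<lambda>\<omega>. f (U \<omega>)) \<Otimes>\<^sub>M distr M P (\<lambda>\<omega>. h (V \<omega>))"
proof -
  interpret prob_space M by fact
  interpret H: prob_space "distr M P (\<lambda>\<omega>. h (V \<omega>))" by (rule prob_space_distr) measurable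
  have a: "distr (distr M A U) S f = distr M S (\<lambda>\<omega>. f (U \<omega>))" "distr (distr M C V) P h = distr M P (\<lambda>\<omega>. h (V \<omega>))"
    by (simp_all add: distr_distr o_def)
  have "distr (distr M A U) S f \<Otimes>\<^sub>M distr (distr M C V) P h
      = distr (distr M A U \<Otimes>\<^sub>M distr M C V) (S \<Otimes>\<^sub>M P) (\<lambda>(x, y). (f x, h y))"
    by (rule pair_measure_distr) (simp_all add: a H.sigma_finite_measure_axioms)
  also have "\<dots> = distr M (S \<Otimes>\<^sub>M P) (\<lambda>\<omega>. (f (U \<omega>), h (V \<omega>)))"
    unfolding eq[symmetric] by (subst distr_distr) (auto simp: o_def)
  finally show ?thesis by (simp add: a)
qed

lemma brownian_increments_distr:
  assumes bm: "brownian_motion W b"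
  shows "distr W (PiM {..<Suc n} (\<lambda>_. borel))
      (\<lambda>\<omega>. \<lambda>k\<in>{..<Suc n}. b (real (Suc k) / real (Suc n)) \<omega> - b (real k / real (Suc n)) \<omega>)
    = PiM {..<Suc n} (\<lambda>_. gaussian_measure 0 (sqrt (1 / real (Suc n))))"
proof -
  interpret prob_space W using bm by (simp add: brownian_motion_def)
  define \<tau> where "\<tau> k = real k / real (Suc n)" for k
  have meas: "b (\<tau> k) \<in> borel_measurable W" for k
    using bm by (simp add: brownian_motion_def \<tau>_def)
  have mono: "0 \<le> \<tau> 0 \<and> (\<forall>k<Suc n. \<tau> k \<le> \<tau> (Suc k))" by (auto simp: \<tau>_def divide_right_mono)
  then have ind: "indep_vars (\<lambda>_. borel) (\<lambda>k \<omega>. b (\<tau> (Suc k)) \<omega> - b (\<tau> k) \<omega>) {..<Suc n}"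
    using bm unfolding brownian_motion_def by blast
  have one: "distr W borel (\<lambda>\<omega>. b (\<tau> (Suc k)) \<omega> - b (\<tau> k) \<omega>) = gaussian_measure 0 (sqrt (1 / real (Suc n)))" for k
  proof -
    have "0 \<le> \<tau> k" "\<tau> k < \<tau> (Suc k)" by (auto simp: \<tau>_def divide_strict_right_mono)
    then have "distributed W lborel (\<lambda>\<omega>. b (\<tau> (Suc k)) \<omega> - b (\<tau> k) \<omega>) (normal_density 0 (sqrt (\<tau> (Suc k) - \<tau> k)))"
      using bm unfolding brownian_motion_def by blast
    moreover have "\<tau> (Suc k) - \<tau> k = 1 / real (Suc n)" by (simp add: \<tau>_def diff_divide_distrib[symmetric])
    ultimately show ?thesis by (simp add: distributed_def gaussian_measure_def cong: distr_cong)
  qed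
  have "distr W (PiM {..<Suc n} (\<lambda>_. borel)) (\<lambda>\<omega>. \<lambda>k\<in>{..<Suc n}. b (\<tau> (Suc k)) \<omega> - b (\<tau> k) \<omega>)
      = PiM {..<Suc n} (\<lambda>k. distr W borel (\<lambda>\<omega>. b (\<tau> (Suc k)) \<omega> - b (\<tau> k) \<omega>))"
    by (rule indep_vars_iff_distr_eq_PiM'[THEN iffD1, OF _ _ ind]) (use meas in auto)
  also have "\<dots> = PiM {..<Suc n} (\<lambda>_. gaussian_measure 0 (sqrt (1 / real (Suc n))))"
    by (simp only: one)
  finally show ?thesis unfolding \<tau>_def .
qed

text \<open>A continuous function that is positive exactly on the ball. Integrals of it converge
  along the discretisation, which indicators of balls need not do, yet their vanishing still says
  that the ball is null.\<close>

definition bump :: "'a::metric_space \<Rightarrow> real \<Rightarrow> 'a \<Rightarrow> ennreal" where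
  "bump z r x = ennreal (max 0 (1 - dist x z / r))"

lemma bump_le_1: "0 < r \<Longrightarrow> bump z r x \<le> 1"
  by (simp add: bump_def ennreal_le_1)

lemma bump_eq_0_iff: "0 < r \<Longrightarrow> bump z r x = 0 \<longleftrightarrow> x \<notin> ball z r"
  by (auto simp: bump_def ennreal_eq_0_iff dist_commute field_simps)

lemma continuous_bump: "0 < r \<Longrightarrow> continuous_on UNIV (bump z r)"
  unfolding bump_def[abs_def] by (intro continuous_on_ennreal continuous_intros) auto

section \<open>Controllability implies full support\<close>

context harmonic_network
begin

text \<open>Noise from the other boundary vertices is collected in \<open>f\<close> and left
  untouched; only the increments of \<open>B i\<close>, which are independent of it, are shifted. By
  linearity of the discretised Duhamel formula, the shift by scaled increments of
  \<open>\<phi>\<close> adds exactly the sum belonging to the control. The error term does not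
  depend on \<open>n\<close>.\<close>

lemma gaussian_shift_bound_discretised:
  assumes brownian: "indep_brownian_motions W bdry B" and i: "i \<in> bdry" "0 < T i" and c: "0 < c" and r: "0 < r"
    and \<phi>: "\<phi> 0 = 0" "\<And>s t. 0 \<le> s \<Longrightarrow> s \<le> t \<Longrightarrow> t \<le> 1 \<Longrightarrow> \<bar>\<phi> t - \<phi> s\<bar> \<le> K * (t - s)"
  shows "(\<integral>\<^sup>+ \<omega>. bump z r (duhamel_sum M n (noise_path bdry T B \<omega>)) \<partial>W)
    \<le> ennreal (c / 2) * (\<integral>\<^sup>+ \<omega>. bump z r (duhamel_sum M n (noise_path bdry T B \<omega>)
          + duhamel_sum M n (\<lambda>t. \<phi> t *\<^sub>R axis (Inr i) 1)) \<partial>W)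
      + ennreal (exp (K\<^sup>2 / (2 * T i)) / (2 * c))"
proof -
  define a where "a = sqrt (2 * T i)"
  have a: "0 < a" "a\<^sup>2 = 2 * T i" using i(2) by (simp_all add: a_def)
  define m where "m = Suc n"
  define S where "S j \<beta> = duhamel_sum M n (\<lambda>t. \<beta> t *\<^sub>R axis (Inr j) 1)" for j and \<beta> :: "real \<Rightarrow> real"
  define paths where "paths = (\<lambda>_ :: 'v. PiM {0 :: real..} (\<lambda>_. borel :: real measure))"
  define P where "P = PiM {..<m} (\<lambda>_. borel :: real measure)"
  define U where "U J \<omega> = (\<lambda>j\<in>J. \<lambda>t\<in>{0..}. B j t \<omega>)" for J \<omega>
  define f where "f h = (\<Sum>j\<in>bdry - {i}. sqrt (2 * T j) *\<^sub>R S j (h j))" for h :: "'v \<Rightarrow> real \<Rightarrow> real"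
  define \<Delta> where "\<Delta> h = (\<lambda>k\<in>{..<m}. h i (real (Suc k) / real m) - h i (real k / real m))" for h :: "'v \<Rightarrow> real \<Rightarrow> real"
  \<comment> \<open>Rebuilds the path at vertex \<open>i\<close> from its increments. At a grid time
    k/m the floor is exactly k, and \<open>duhamel_sum\<close> looks at no other times.\<close>
  define L where "L x = a *\<^sub>R S i (\<lambda>t. \<Sum>k<nat \<lfloor>real m * t\<rfloor>. x k)" for x :: "nat \<Rightarrow> real"
  \<comment> \<open>The division by \<open>a\<close> compensates the factor \<open>a\<close> in
    \<open>L\<close>.\<close>
  define s where "s k = \<phi> (real (Suc k) / real m) / a - \<phi> (real k / real m) / a" for k
  have m0: "0 < real m" by (simp add: m_def)
  have bm: "brownian_motion W (B j)" if "j \<in> bdry" for j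
    using brownian that by (simp add: indep_brownian_motions_def)

  have S_cong: "S j \<beta> = S j \<beta>'" if "\<And>k. k \<le> m \<Longrightarrow> \<beta> (real k / real m) = \<beta>' (real k / real m)" for j \<beta> \<beta>'
    unfolding S_def using that by (intro duhamel_sum_cong) (simp add: m_def)
  have S_meas: "(\<lambda>x. S j (b x)) \<in> borel_measurable N"
    if "\<And>k. k \<le> m \<Longrightarrow> (\<lambda>x. b x (real k / real m)) \<in> borel_measurable N" for j N and b :: "'z \<Rightarrow> real \<Rightarrow> real"
    unfolding S_def
    by (intro borel_measurable_duhamel_sum borel_measurable_scaleR that[unfolded m_def] borel_measurable_const)
  have path_measurable: "(\<lambda>h. h j t) \<in> borel_measurable (PiM J paths)" if "j \<in> J" "0 \<le> t" for j t J
    unfolding paths_def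
    by (rule measurable_compose[OF measurable_component_singleton[OF that(1)] measurable_component_singleton]) (use that in simp)
  have fm: "f \<in> borel_measurable (PiM (bdry - {i}) paths)"
    unfolding f_def[abs_def]
    by (intro borel_measurable_sum borel_measurable_scaleR borel_measurable_const S_meas path_measurable) auto
  have \<Delta>m: "\<Delta> \<in> measurable (PiM {i} paths) P"
    unfolding \<Delta>_def[abs_def] P_def
    by (intro measurable_restrict borel_measurable_diff path_measurable) auto
  have Lm: "L \<in> borel_measurable P"
    unfolding L_def[abs_def] P_def
    by (intro borel_measurable_scaleR borel_measurable_const S_meas borel_measurable_sum measurable_component_singleton)
       (use m0 in auto)
  have Um: "U J \<in> measurable W (PiM J paths)" if "J \<subseteq> bdry" for J
    unfolding U_def[abs_def] paths_def
    by (intro measurable_restrict) (use bm that in \<open>auto simp: brownian_motion_def\<close>)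

  have "indep_vars paths (\<lambda>j \<omega>. \<lambda>t\<in>{0..}. B j t \<omega>) bdry"
    using brownian by (simp add: indep_brownian_motions_def paths_def)
  then have "indep_var (PiM (bdry - {i}) paths) (U (bdry - {i})) (PiM {i} paths) (U {i})"
    unfolding U_def[abs_def] by (rule indep_var_restrict) (use i in auto)
  then have "distr W (PiM (bdry - {i}) paths \<Otimes>\<^sub>M PiM {i} paths) (\<lambda>\<omega>. (U (bdry - {i}) \<omega>, U {i} \<omega>))
      = distr W (PiM (bdry - {i}) paths) (U (bdry - {i})) \<Otimes>\<^sub>M distr W (PiM {i} paths) (U {i})"
    by (simp add: indep_var_distribution_eq)
  \<comment> \<open>Independence of whole paths is pushed forward to the two finite-dimensional
    quantities that enter the sum.\<close>
  then have joint: "distr W (borel \<Otimes>\<^sub>M P) (\<lambda>\<omega>. (f (U (bdry - {i}) \<omega>), \<Delta> (U {i} \<omega>)))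
      = distr W borel (\<lambda>\<omega>. f (U (bdry - {i}) \<omega>)) \<Otimes>\<^sub>M distr W P (\<lambda>\<omega>. \<Delta> (U {i} \<omega>))"
    using i by (intro distr_pair_product_map[OF prob_space_axioms _ _ fm \<Delta>m] Um) auto
  have \<Delta>_eq: "\<Delta> (U {i} \<omega>) = (\<lambda>k\<in>{..<m}. B i (real (Suc k) / real m) \<omega> - B i (real k / real m) \<omega>)" for \<omega>
    by (auto simp: \<Delta>_def U_def)
  have law: "distr W P (\<lambda>\<omega>. \<Delta> (U {i} \<omega>)) = PiM {..<m} (\<lambda>_. gaussian_measure 0 (sqrt (1 / real m)))"
    unfolding \<Delta>_eq P_def m_def by (rule brownian_increments_distr[OF bm[OF i(1)]])

  have floor: "nat \<lfloor>real m * (real k / real m)\<rfloor> = k" for k using m0 by simp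
  have noise: "AE \<omega> in W. duhamel_sum M n (noise_path bdry T B \<omega>) = f (U (bdry - {i}) \<omega>) + L (\<Delta> (U {i} \<omega>))"
  proof -
    \<comment> \<open>Without a start at 0 the telescoped increments would give the path only up to
      its initial value.\<close>
    have "AE \<omega> in W. B i 0 \<omega> = 0" using bm[OF i(1)] by (simp add: brownian_motion_def)
    then show ?thesis
    proof eventually_elim
      case (elim \<omega>)
      have "noise_path bdry T B \<omega> = (\<lambda>t. \<Sum>j\<in>bdry. sqrt (2 * T j) *\<^sub>R (B j t \<omega> *\<^sub>R axis (Inr j) 1))"
        by (simp add: noise_path_def fun_eq_iff)
      then have "duhamel_sum M n (noise_path bdry T B \<omega>) = (\<Sum>j\<in>bdry. sqrt (2 * T j) *\<^sub>R S j (\<lambda>t. B j t \<omega>))"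
        by (simp only: duhamel_sum_sum duhamel_sum_scaleR S_def)
      also have "\<dots> = (\<Sum>j\<in>bdry - {i}. sqrt (2 * T j) *\<^sub>R S j (\<lambda>t. B j t \<omega>)) + a *\<^sub>R S i (\<lambda>t. B i t \<omega>)"
        using i(1) by (subst sum.remove[of bdry i]) (auto simp: a_def)
      also have "(\<Sum>j\<in>bdry - {i}. sqrt (2 * T j) *\<^sub>R S j (\<lambda>t. B j t \<omega>)) = f (U (bdry - {i}) \<omega>)"
        unfolding f_def by (intro sum.cong refl arg_cong2[of _ _ _ _ "(*\<^sub>R)"] S_cong) (simp add: U_def)
      also have "S i (\<lambda>t. B i t \<omega>) = S i (\<lambda>t. \<Sum>k<nat \<lfloor>real m * t\<rfloor>. \<Delta> (U {i} \<omega>) k)"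
      proof (rule S_cong)
        fix k assume k: "k \<le> m"
        have "(\<Sum>l<k. \<Delta> (U {i} \<omega>) l) = (\<Sum>l<k. B i (real (Suc l) / real m) \<omega> - B i (real l / real m) \<omega>)"
          unfolding \<Delta>_eq by (intro sum.cong) (use k in auto)
        also have "\<dots> = B i (real k / real m) \<omega>"
          by (subst sum_lessThan_telescope) (simp add: elim)
        finally show "B i (real k / real m) \<omega> = (\<Sum>l<nat \<lfloor>real m * (real k / real m)\<rfloor>. \<Delta> (U {i} \<omega>) l)"
          unfolding floor by simp
      qed
      finally show ?case by (simp add: L_def)
    qed
  qed
  have Lshift: "L (\<lambda>k\<in>{..<m}. x k + s k) = L x + S i \<phi>" for x
  proof -
    have "S i (\<lambda>t. \<Sum>k<nat \<lfloor>real m * t\<rfloor>. (\<lambda>k\<in>{..<m}. x k + s k) k)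
        = S i (\<lambda>t. (\<Sum>k<nat \<lfloor>real m * t\<rfloor>. x k) + (1 / a) * \<phi> t)"
    proof (rule S_cong)
      fix k assume k: "k \<le> m"
      have "(\<Sum>l<k. (\<lambda>k\<in>{..<m}. x k + s k) l) = (\<Sum>l<k. x l + s l)"
        by (intro sum.cong) (use k in auto)
      also have "\<dots> = (\<Sum>l<k. x l) + (\<Sum>l<k. s l)" by (rule sum.distrib)
      also have "(\<Sum>l<k. s l) = \<phi> (real k / real m) / a"
        unfolding s_def by (subst sum_lessThan_telescope) (simp add: \<phi>(1))
      finally show "(\<Sum>l<nat \<lfloor>real m * (real k / real m)\<rfloor>. (\<lambda>k\<in>{..<m}. x k + s k) l)
          = (\<Sum>l<nat \<lfloor>real m * (real k / real m)\<rfloor>. x l) + (1 / a) * \<phi> (real k / real m)"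
        unfolding floor by simp
    qed
    also have "\<dots> = S i (\<lambda>t. \<Sum>k<nat \<lfloor>real m * t\<rfloor>. x k) + (1 / a) *\<^sub>R S i \<phi>"
      by (simp only: S_def scaleR_add_left duhamel_sum_add scaleR_scaleR[symmetric] duhamel_sum_scaleR)
    finally show ?thesis using a(1) by (simp add: L_def scaleR_add_right)
  qed

  \<comment> \<open>Each shift has size at most K/(a m). There are m of them, measured against the
    variance 1/m, so the powers of m cancel and the square of \<open>a\<close>, that is 2 T i,
    remains in the denominator.\<close>
  have q: "(\<Sum>k<m. (s k)\<^sup>2) / (sqrt (1 / real m))\<^sup>2 \<le> K\<^sup>2 / (2 * T i)"
  proof -
    have sk: "(s k)\<^sup>2 \<le> K\<^sup>2 / (2 * T i) / (real m)\<^sup>2" if k: "k < m" for k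
    proof -
      have "\<bar>\<phi> (real (Suc k) / real m) - \<phi> (real k / real m)\<bar> \<le> K * (real (Suc k) / real m - real k / real m)"
        by (rule \<phi>(2)) (use k m0 in \<open>auto simp: field_simps\<close>)
      also have "\<dots> = K / real m" by (simp add: diff_divide_distrib[symmetric])
      finally have le: "\<bar>\<phi> (real (Suc k) / real m) - \<phi> (real k / real m)\<bar> / a \<le> K / real m / a"
        using a(1) by (intro divide_right_mono) auto
      have "(s k)\<^sup>2 = (\<bar>\<phi> (real (Suc k) / real m) - \<phi> (real k / real m)\<bar> / a)\<^sup>2"
        by (simp only: s_def diff_divide_distrib[symmetric] power_divide power2_abs)
      also have "\<dots> \<le> (K / real m / a)\<^sup>2"
        by (intro power_mono le divide_nonneg_pos a) simp
      finally show ?thesis by (simp add: power_divide power_mult_distrib a(2) mult.commute)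
    qed
    have "(\<Sum>k<m. (s k)\<^sup>2) \<le> (\<Sum>k<m. K\<^sup>2 / (2 * T i) / (real m)\<^sup>2)"
      by (intro sum_mono sk) auto
    also have "\<dots> = K\<^sup>2 / (2 * T i) / real m" using m0 by (simp add: power2_eq_square)
    finally have le: "(\<Sum>k<m. (s k)\<^sup>2) \<le> K\<^sup>2 / (2 * T i) / real m" .
    have "x / (sqrt (1 / real m))\<^sup>2 \<le> y" if "x \<le> y / real m" for x y :: real
      using that m0 by (simp add: pos_le_divide_eq)
    from this[OF le] show ?thesis .
  qed
  define F where "F y x = bump z r (y + L x)" for y x
  have bump_m: "bump z r \<in> borel_measurable borel"
    by (rule borel_measurable_continuous_onI[OF continuous_bump[OF r]])
  have "(\<integral>\<^sup>+ \<omega>. F (f (U (bdry - {i}) \<omega>)) (\<Delta> (U {i} \<omega>)) \<partial>W)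
      \<le> ennreal (c / 2) * (\<integral>\<^sup>+ \<omega>. F (f (U (bdry - {i}) \<omega>)) (\<lambda>k\<in>{..<m}. \<Delta> (U {i} \<omega>) k + s k) \<partial>W)
      + ennreal (exp ((\<Sum>k<m. (s k)\<^sup>2) / (sqrt (1 / real m))\<^sup>2) / (2 * c))"
  proof (rule indep_gaussian_shift_bound[where S = borel])
    show "(\<lambda>\<omega>. f (U (bdry - {i}) \<omega>)) \<in> borel_measurable W"
      by (rule measurable_compose[OF Um fm]) auto
    show "(\<lambda>\<omega>. \<Delta> (U {i} \<omega>)) \<in> measurable W (PiM {..<m} (\<lambda>_. borel))"
      using measurable_compose[OF Um \<Delta>m] i by (simp add: P_def)
    show "case_prod F \<in> borel_measurable (borel \<Otimes>\<^sub>M PiM {..<m} (\<lambda>_. borel))"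
    proof -
      note [measurable] = bump_m Lm[unfolded P_def]
      show ?thesis unfolding F_def by measurable
    qed
  qed (use m0 c joint law in \<open>auto simp: P_def F_def bump_le_1[OF r]\<close>)
  also have "(\<integral>\<^sup>+ \<omega>. F (f (U (bdry - {i}) \<omega>)) (\<lambda>k\<in>{..<m}. \<Delta> (U {i} \<omega>) k + s k) \<partial>W)
      = (\<integral>\<^sup>+ \<omega>. bump z r (duhamel_sum M n (noise_path bdry T B \<omega>) + S i \<phi>) \<partial>W)"
    by (rule nn_integral_cong_AE, use noise in eventually_elim) (simp only: F_def Lshift add.assoc)
  also have "(\<integral>\<^sup>+ \<omega>. F (f (U (bdry - {i}) \<omega>)) (\<Delta> (U {i} \<omega>)) \<partial>W)
      = (\<integral>\<^sup>+ \<omega>. bump z r (duhamel_sum M n (noise_path bdry T B \<omega>)) \<partial>W)"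
    by (rule nn_integral_cong_AE, use noise in eventually_elim) (simp only: F_def)
  also have "ennreal (exp ((\<Sum>k<m. (s k)\<^sup>2) / (sqrt (1 / real m))\<^sup>2) / (2 * c)) \<le> ennreal (exp (K\<^sup>2 / (2 * T i)) / (2 * c))"
    using q c by (intro ennreal_leI divide_right_mono) auto
  finally show ?thesis by (simp add: S_def add_left_mono)
qed

text \<open>As n tends to infinity the term with the shifted solution tends to 0 by hypothesis. What
  remains is a bound D/(2c) with D independent of c, and c may be taken arbitrarily large.\<close>

lemma solution_avoids_shifted_ball:
  assumes brownian: "indep_brownian_motions W bdry B" and i: "i \<in> bdry" "0 < T i" and r: "0 < r"
    and v: "reachable M (axis (Inr i) 1) v"
    and avoid: "AE \<omega> in W. Z 0 1 \<omega> + v \<notin> ball z r"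
  shows "AE \<omega> in W. Z 0 1 \<omega> \<notin> ball z r"
proof -
  obtain \<phi> K where \<phi>: "\<phi> 0 = 0" "\<And>s t. 0 \<le> s \<Longrightarrow> s \<le> t \<Longrightarrow> t \<le> 1 \<Longrightarrow> \<bar>\<phi> t - \<phi> s\<bar> \<le> K * (t - s)"
     "(\<lambda>n. duhamel_sum M n (\<lambda>t. \<phi> t *\<^sub>R axis (Inr i) 1)) \<longlonglongrightarrow> v"
    using v unfolding reachable_def by blast
  define X where "X n \<omega> = duhamel_sum M n (noise_path bdry T B \<omega>)" for n \<omega>
  define u where "u n = duhamel_sum M n (\<lambda>t. \<phi> t *\<^sub>R axis (Inr i) 1)" for n
  have Xm[measurable]: "X n \<in> borel_measurable W" for n
  proof -
    have "B j t \<in> borel_measurable W" if "j \<in> bdry" "0 \<le> t" for j t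
      using brownian that by (auto simp: indep_brownian_motions_def brownian_motion_def)
    then have "(\<lambda>\<omega>. noise_path bdry T B \<omega> t) \<in> borel_measurable W" if "0 \<le> t" for t
      unfolding noise_path_def using that
      by (intro borel_measurable_sum borel_measurable_scaleR borel_measurable_times borel_measurable_const) auto
    then show ?thesis unfolding X_def[abs_def] by (intro borel_measurable_duhamel_sum) auto
  qed
  have [measurable]: "Z 0 1 \<in> borel_measurable W" by (rule solution_measurable) simp
  have bump_m[measurable]: "bump z r \<in> borel_measurable borel"
    by (rule borel_measurable_continuous_onI[OF continuous_bump[OF r]])
  have X: "AE \<omega> in W. (\<lambda>n. X n \<omega>) \<longlonglongrightarrow> Z 0 1 \<omega>"
    using solution_path[of 0]
  proof eventually_elim
    case (elim \<omega>)
    then show ?case unfolding X_def by (intro duhamel_sum_tendsto_solution[of "\<lambda>t. Z 0 t \<omega>"]) auto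
  qed
  have bump_tendsto: "(\<lambda>n. bump z r (x n)) \<longlonglongrightarrow> bump z r y" if "x \<longlonglongrightarrow> y" for x y
    using continuous_on_tendsto_compose[OF continuous_bump[OF r] that] by auto
  have lim1: "(\<lambda>n. \<integral>\<^sup>+ \<omega>. bump z r (X n \<omega>) \<partial>W) \<longlonglongrightarrow> (\<integral>\<^sup>+ \<omega>. bump z r (Z 0 1 \<omega>) \<partial>W)"
  proof (rule nn_integral_dominated_convergence[where w = "\<lambda>_. 1"])
    show "AE \<omega> in W. (\<lambda>n. bump z r (X n \<omega>)) \<longlonglongrightarrow> bump z r (Z 0 1 \<omega>)"
      using X by eventually_elim (rule bump_tendsto)
  qed (auto simp: emeasure_space_1 bump_le_1[OF r])
  have lim2: "(\<lambda>n. \<integral>\<^sup>+ \<omega>. bump z r (X n \<omega> + u n) \<partial>W) \<longlonglongrightarrow> (\<integral>\<^sup>+ \<omega>. bump z r (Z 0 1 \<omega> + v) \<partial>W)"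
  proof (rule nn_integral_dominated_convergence[where w = "\<lambda>_. 1"])
    show "AE \<omega> in W. (\<lambda>n. bump z r (X n \<omega> + u n)) \<longlonglongrightarrow> bump z r (Z 0 1 \<omega> + v)"
      using X by eventually_elim (intro bump_tendsto tendsto_add \<phi>(3)[folded u_def])
  qed (auto simp: emeasure_space_1 bump_le_1[OF r])
  have zero: "(\<integral>\<^sup>+ \<omega>. bump z r (Z 0 1 \<omega> + v) \<partial>W) = 0"
    using avoid by (subst nn_integral_0_iff_AE) (auto simp: bump_eq_0_iff[OF r])
  define D where "D = exp (K\<^sup>2 / (2 * T i))"
  have bound: "(\<integral>\<^sup>+ \<omega>. bump z r (Z 0 1 \<omega>) \<partial>W) \<le> ennreal (D / (2 * c))" if c: "0 < c" for c
  proof -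
    have "(\<lambda>n. ennreal (c / 2) * (\<integral>\<^sup>+ \<omega>. bump z r (X n \<omega> + u n) \<partial>W) + ennreal (D / (2 * c)))
        \<longlonglongrightarrow> ennreal (c / 2) * 0 + ennreal (D / (2 * c))"
      using lim2 unfolding zero by (intro tendsto_add tendsto_const ennreal_tendsto_cmult) auto
    moreover have "(\<integral>\<^sup>+ \<omega>. bump z r (X n \<omega>) \<partial>W)
        \<le> ennreal (c / 2) * (\<integral>\<^sup>+ \<omega>. bump z r (X n \<omega> + u n) \<partial>W) + ennreal (D / (2 * c))" for n
      unfolding X_def u_def D_def by (rule gaussian_shift_bound_discretised[OF brownian i c r \<phi>(1,2)])
    ultimately show ?thesis using LIMSEQ_le[OF lim1] by auto
  qed
  have "(\<integral>\<^sup>+ \<omega>. bump z r (Z 0 1 \<omega>) \<partial>W) \<le> 0"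
  proof (rule ennreal_le_epsilon)
    fix e :: real assume e: "0 < e"
    have D: "0 < D" by (simp add: D_def)
    then have "D / (2 * (D / (2 * e))) = e" using e by (simp add: field_simps)
    \<comment> \<open>The choice c = D/(2e) makes the error D/(2c) equal to e.\<close>
    then show "(\<integral>\<^sup>+ \<omega>. bump z r (Z 0 1 \<omega>) \<partial>W) \<le> 0 + ennreal e"
      using bound[of "D / (2 * e)"] D e by simp
  qed
  then have "(\<integral>\<^sup>+ \<omega>. bump z r (Z 0 1 \<omega>) \<partial>W) = 0" by simp
  then show ?thesis by (subst (asm) nn_integral_0_iff_AE) (auto simp: bump_eq_0_iff[OF r])
qed

text \<open>A general displacement is a sum of reachable vectors belonging to different boundary
  vertices, so it is removed one summand at a time. One null ball then makes all balls of the same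
  radius null.\<close>

lemma solution_hits_balls:
  assumes brownian: "indep_brownian_motions W bdry B" and T: "\<And>i. i \<in> bdry \<Longrightarrow> 0 < T i" and r: "0 < r"
    and ctrl: "controllable_space M bdry = UNIV"
  shows "\<not> (AE \<omega> in W. Z 0 1 \<omega> \<notin> ball z r)"
proof
  assume avoid: "AE \<omega> in W. Z 0 1 \<omega> \<notin> ball z r"
  let ?R = "{v. \<exists>i\<in>bdry. reachable M (axis (Inr i) 1) v}"
  \<comment> \<open>The centre is quantified inside the induction because removing a summand moves
    the ball by the remaining ones.\<close>
  have "\<forall>y. (AE \<omega> in W. Z 0 1 \<omega> + v \<notin> ball y r) \<longrightarrow> (AE \<omega> in W. Z 0 1 \<omega> \<notin> ball y r)"
    if "v \<in> span ?R" for v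
    using that
  proof (induction rule: span_induct_alt)
    case (step c x v)
    then obtain i where i: "i \<in> bdry" "reachable M (axis (Inr i) 1) (c *\<^sub>R x)"
      using reachable_scaleR by blast
    show ?case
    proof (intro allI impI)
      fix y assume "AE \<omega> in W. Z 0 1 \<omega> + (c *\<^sub>R x + v) \<notin> ball y r"
      then have "AE \<omega> in W. Z 0 1 \<omega> + c *\<^sub>R x \<notin> ball (y - v) r"
        by (simp add: dist_norm algebra_simps)
      then have "AE \<omega> in W. Z 0 1 \<omega> \<notin> ball (y - v) r"
        using solution_avoids_shifted_ball[OF brownian i(1) T[OF i(1)] r i(2)] by blast
      then have "AE \<omega> in W. Z 0 1 \<omega> + v \<notin> ball y r"
        by (simp add: dist_norm algebra_simps)
      then show "AE \<omega> in W. Z 0 1 \<omega> \<notin> ball y r" using step by blast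
    qed
  qed simp
  then have shift: "AE \<omega> in W. Z 0 1 \<omega> \<notin> ball y r" if "AE \<omega> in W. Z 0 1 \<omega> + v \<notin> ball y r" for v y
    using that span_reachable[OF ctrl] by blast
  have avoid_all: "AE \<omega> in W. Z 0 1 \<omega> \<notin> ball y r" for y
    by (rule shift[of "y - z"]) (use avoid in \<open>simp add: dist_norm algebra_simps\<close>)
  \<comment> \<open>Countably many null balls with dense centres cover the space, leaving no place
    for \<open>Z 0 1\<close>.\<close>
  obtain C :: "(real ^ ('v + 'v)) set" where C: "countable C" "\<And>G. open G \<Longrightarrow> G \<noteq> {} \<Longrightarrow> \<exists>d\<in>C. d \<in> G"
    using countable_dense_exists by blast
  have "AE \<omega> in W. \<forall>y\<in>C. Z 0 1 \<omega> \<notin> ball y r"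
    using C(1) avoid_all by (simp add: AE_ball_countable)
  then have "AE \<omega> in W. False"
  proof eventually_elim
    case (elim \<omega>)
    obtain y where "y \<in> C" "y \<in> ball (Z 0 1 \<omega>) r"
      using C(2)[of "ball (Z 0 1 \<omega>) r"] r by force
    then show ?case using elim by (auto simp: dist_commute)
  qed
  then show False by simp
qed

text \<open>If \<open>G\<close> were null, invariance at time one would give a starting point from
  which \<open>G\<close> is almost surely missed. Translating by the flow of that point, the
  solution from 0 would miss a ball.\<close>

lemma full_support_if_controllable:
  assumes brownian: "indep_brownian_motions W bdry B" and T: "\<And>i. i \<in> bdry \<Longrightarrow> 0 < T i"
    and ctrl: "controllable_space M bdry = UNIV"
    and inv: "invariant_prob (transition W Z) \<mu>"
  shows "measure_support \<mu> = UNIV"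
proof -
  have pos: "0 < emeasure \<mu> G" if G: "open G" "z \<in> G" for G z
  proof (rule ccontr)
    interpret \<mu>: prob_space \<mu> using inv by (simp add: invariant_prob_def)
    have sets[measurable_cong]: "sets \<mu> = sets borel" using inv by (simp add: invariant_prob_def)
    obtain r where r: "0 < r" "ball z r \<subseteq> G" using G open_contains_ball by blast
    have Gb[measurable]: "G \<in> sets borel" using G by simp
    have [measurable]: "Z 0 1 \<in> borel_measurable W" by (rule solution_measurable) simp
    assume "\<not> 0 < emeasure \<mu> G"
    then have "(\<integral>\<^sup>+ x. emeasure (transition W Z 1 x) G \<partial>\<mu>) = 0"
      using inv Gb by (simp add: invariant_prob_def)
    moreover have "(\<lambda>x. emeasure (transition W Z 1 x) G) \<in> borel_measurable \<mu>"
      using transition_measurable[of 1 G] by (simp cong: measurable_cong_sets[OF sets refl])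
    ultimately have null: "AE x in \<mu>. emeasure (transition W Z 1 x) G = 0"
      by (simp add: nn_integral_0_iff_AE)
    \<comment> \<open>A property that holds almost everywhere for a probability measure holds
      somewhere; one starting point is enough.\<close>
    have "\<exists>x. emeasure (transition W Z 1 x) G = 0"
    proof (rule ccontr)
      assume "\<nexists>x. emeasure (transition W Z 1 x) G = 0"
      then have "AE x in \<mu>. False" using null by simp
      then show False by simp
    qed
    then obtain x where "emeasure (transition W Z 1 x) G = 0" by blast
    then have "emeasure W {\<omega> \<in> space W. flow M 1 x + Z 0 1 \<omega> \<in> G} = 0"
      by (simp add: emeasure_transition)
    then have "AE \<omega> in W. flow M 1 x + Z 0 1 \<omega> \<notin> G"
      by (subst AE_iff_measurable[OF _ refl]) auto
    then have "AE \<omega> in W. Z 0 1 \<omega> \<notin> ball (z - flow M 1 x) r"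
    proof eventually_elim
      case (elim \<omega>)
      then have "flow M 1 x + Z 0 1 \<omega> \<notin> ball z r" using r by blast
      then show ?case by (simp add: dist_norm algebra_simps)
    qed
    then show False using solution_hits_balls[OF brownian T r(1) ctrl] by blast
  qed
  then show ?thesis unfolding measure_support_def by blast
qed

end

theorem mainTheorem2:
  fixes adj :: "'v::finite \<Rightarrow> 'v \<Rightarrow> bool"
    and damped bdry :: "'v set"
    and T :: "'v \<Rightarrow> real"
    and U V :: "real \<Rightarrow> real"
    and W :: "'w measure"
    and B :: "'v \<Rightarrow> real \<Rightarrow> 'w \<Rightarrow> real"
    and Z :: "'v phase \<Rightarrow> real \<Rightarrow> 'w \<Rightarrow> 'v phase"
    and \<mu> :: "'v phase measure"
  assumes graph: "connected_graph adj"
    and damped: "damped \<noteq> {}"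
    and bdry: "bdry \<noteq> {}" "bdry \<subseteq> damped"
    and temperatures: "\<And>i. i \<in> bdry \<Longrightarrow> T i > 0"
    and harmonic: "U = (\<lambda>x. x\<^sup>2 / 2)" "V = (\<lambda>x. x\<^sup>2 / 2)"
    and brownian: "prob_space W" "indep_brownian_motions W bdry B"
    and diffusion: "\<And>z. network_solution adj U V damped bdry T W B z (Z z)"
    and invariant: "invariant_prob (transition W Z) \<mu>"
    and unique: "\<And>\<nu>. invariant_prob (transition W Z) \<nu> \<Longrightarrow> \<nu> = \<mu>"
  shows "measure_support \<mu> = UNIV \<longleftrightarrow>
         dim (controllable_space (drift_matrix adj damped) bdry) = 2 * CARD('v)"
proof -
  interpret prob_space W by (rule brownian(1))
  interpret harmonic_network adj damped bdry T W B Z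
    by unfold_locales (use graph diffusion harmonic in \<open>auto simp: connected_graph_def symp_def\<close>)
  let ?E = "controllable_space (drift_matrix adj damped) bdry"
  have "dim ?E = 2 * CARD('v) \<longleftrightarrow> dim ?E = DIM(real ^ ('v + 'v))"
    by (simp add: mult_2)
  also have "\<dots> \<longleftrightarrow> span ?E = UNIV" by (rule dim_eq_full)
  also have "\<dots> \<longleftrightarrow> ?E = UNIV" using span_eq_iff[THEN iffD2, OF subspace_controllable_space] by metis
  finally have "dim ?E = 2 * CARD('v) \<longleftrightarrow> ?E = UNIV" .
  then show ?thesis
    using controllable_if_full_support[OF bdry(2) invariant unique]
      full_support_if_controllable[OF brownian(2) temperatures _ invariant] by blast
qed

end
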